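(* Let $K$ be an algebraically closed field, $n\geqslant 3$ and $i\in\{0,\ldots,n-2\}$. Every irreducible representation $\varphi:K_0[M_i]\to M_r(K)$ of $K_0[M_i]$ is such that $\varphi(s_i;1,1)=\lambda e$, where $\lambda\in K^*$ and $e\in M_r(K)$ is an idempotent of rank $1$. Such a representation $\varphi$ can be uniquely extended to an irreducible representation of $K_0[\mathcal{M}^0(\mathrm{gr}(s_i),A_i,B_i;P_i)]$, where $\mathrm{gr}(s_i)$ is the infinite cyclic group generated by $s_i$.
   Context: For $n\geqslant 3$, $C_n$ is the Hecke--Kiselman monoid of the oriented cycle $1\to 2\to\cdots\to n\to 1$: the monoid generated by $x_1,\ldots,x_n$ with relations $x_i^2=x_i$; $x_ix_j=x_jx_i$ if $i,j$ are not connected by an arrow; and $x_ix_jx_i=x_jx_ix_j=x_ix_j$ if there is an arrow $i\to j$. For $i=0,\ldots,n-2$ put $s_i=x_n(x_1x_2\cdots x_i)(x_{n-1}x_{n-2}\cdots x_{i+1})\in C_n$ (for $i=0$ the first bracket is empty), let $\langle s_i\rangle$ be the cyclic submonoid generated by $s_i$, $S_i=\{s_i^k:k\geqslant 1\}$ (infinite), and $I_i=\{x\in C_n: C_nxC_n\cap\langle s_i\rangle=\emptyset\}$, an ideal of $C_n$ (possibly empty). $M_i$ is the ideal of the Rees quotient $C_n/I_i$ generated by $s_i$, with zero $\theta$ included (if $I_i=\emptyset$, $C_n/I_i$ means $C_n$ with a zero $\theta$ adjoined). Semigroup of matrix type: for a semigroup $S$, sets $A,B$ and a $B\times A$ matrix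 $P=(p_{ba})$ with entries in $S^1\cup\{\theta\}$, $\mathcal{M}^0(S,A,B;P)$ consists of $\theta$ and the triples $(s;a,b)$, $s\in S,a\in A,b\in B$, with $(s;a,b)(t;a',b')=(sp_{ba'}t;a,b')$ if $p_{ba'}\neq\theta$ and $\theta$ otherwise. It is known that there are finite subsets $A_i,B_i\subseteq C_n$ containing $1$, with $|A_i|=|B_i|=\binom{n}{i+1}$, and a $B_i\times A_i$ matrix $P_i=(p_{ba})$ with entries in $\langle s_i\rangle\cup\{\theta\}$, such that $(s_i^k;a,b)\mapsto as_i^kb$, $\theta\mapsto\theta$ is an isomorphism of $\mathcal{M}^0(S_i,A_i,B_i;P_i)$ onto $M_i$; here $p_{ba}=s_i^m$ if $s_ibas_i=s_i^{m+2}$ in $C_n/I_i$, and $p_{ba}=\theta$ if $s_ibas_i=\theta$ in $C_n/I_i$. In particular $p_{1,1}=1$. It is also known that $P_i$ (with $\theta$ read as $0$) is invertible as a matrix over the field of rational functions $K(s_i)$. We identify $M_i=\mathcal{M}^0(S_i,A_i,B_i;P_i)\subseteq\mathcal{M}^0(\mathrm{gr}(s_i),A_i,B_i;P_i)$. $K_0[T]$ denotes the contracted semigroup algebra of a semigroup $T$ with zero $\theta$ (semigroup algebra modulo $K\theta$). An irreducible representation into $M_r(K)$ ($r\geqslant 1$) is a homomorphism making $K^r$ a simple module with nonzero action; as $K$ is algebraically closed, it is surjective. *)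

theory Defs
  imports "HOL-Analysis.Analysis" "HOL-Algebra.Elementary_Groups"
begin

section \<open>Monoid presentations and the Hecke--Kiselman monoid of an oriented cycle\<close>

inductive_set pres_cong :: "'x set \<Rightarrow> ('x list \<times> 'x list) set \<Rightarrow> ('x list \<times> 'x list) set"
  for X :: "'x set" and R :: "('x list \<times> 'x list) set" where
  gen: "(u, v) \<in> R \<Longrightarrow> u \<in> lists X \<Longrightarrow> v \<in> lists X \<Longrightarrow> (u, v) \<in> pres_cong X R"
| refl: "u \<in> lists X \<Longrightarrow> (u, u) \<in> pres_cong X R"
| sym: "(u, v) \<in> pres_cong X R \<Longrightarrow> (v, u) \<in> pres_cong X R"
| trans: "(u, v) \<in> pres_cong X R \<Longrightarrow> (v, w) \<in> pres_cong X R \<Longrightarrow> (u, w) \<in> pres_cong X R"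
| ctxt: "(u, v) \<in> pres_cong X R \<Longrightarrow> p \<in> lists X \<Longrightarrow> q \<in> lists X
    \<Longrightarrow> (p @ u @ q, p @ v @ q) \<in> pres_cong X R"

definition presented_monoid :: "'x set \<Rightarrow> ('x list \<times> 'x list) set \<Rightarrow> 'x list set monoid" where
  "presented_monoid X R =
    \<lparr>carrier = lists X // pres_cong X R,
     monoid.mult = (\<lambda>U V. \<Union>u\<in>U. \<Union>v\<in>V. pres_cong X R `` {u @ v}),
     one = pres_cong X R `` {[]}\<rparr>"

definition cycle_arrow :: "nat \<Rightarrow> nat \<Rightarrow> nat \<Rightarrow> bool" where
  "cycle_arrow n i j \<longleftrightarrow> i \<in> {1..n} \<and> j = (if i = n then 1 else i + 1)"

definition hk_rels :: "nat \<Rightarrow> (nat list \<times> nat list) set" where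
  "hk_rels n =
     {([i, i], [i]) | i. i \<in> {1..n}}
   \<union> {([i, j], [j, i]) | i j. i \<in> {1..n} \<and> j \<in> {1..n} \<and>
        \<not> cycle_arrow n i j \<and> \<not> cycle_arrow n j i}
   \<union> {([i, j, i], [i, j]) | i j. cycle_arrow n i j}
   \<union> {([j, i, j], [i, j]) | i j. cycle_arrow n i j}"

text \<open>The generator \<open>x\<^sub>j\<close> is the class of the one-letter word \<open>[j]\<close>.\<close>

definition hk :: "nat \<Rightarrow> nat list set monoid" where
  "hk n = presented_monoid {1..n} (hk_rels n)"

definition hk_word :: "nat \<Rightarrow> nat list \<Rightarrow> nat list set" where
  "hk_word n w = pres_cong {1..n} (hk_rels n) `` {w}"

definition s_elt :: "nat \<Rightarrow> nat \<Rightarrow> nat list set" where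
  "s_elt n i = hk_word n ([n] @ [1..<i + 1] @ rev [i + 1..<n])"

definition s_monoid :: "nat \<Rightarrow> nat \<Rightarrow> nat list set set" where
  "s_monoid n i = {s_elt n i [^]\<^bsub>hk n\<^esub> k | k :: nat. True}"

definition s_semigroup :: "nat \<Rightarrow> nat \<Rightarrow> nat list set set" where
  "s_semigroup n i = {s_elt n i [^]\<^bsub>hk n\<^esub> k | k :: nat. k \<ge> 1}"

definition I_ideal :: "nat \<Rightarrow> nat \<Rightarrow> nat list set set" where
  "I_ideal n i = {x \<in> carrier (hk n).
     {u \<otimes>\<^bsub>hk n\<^esub> x \<otimes>\<^bsub>hk n\<^esub> v | u v. u \<in> carrier (hk n) \<and> v \<in> carrier (hk n)} \<inter> s_monoid n i = {}}"


section \<open>Semigroups with zero\<close>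

record 'a semigroup0 = "'a partial_object" +
  smult :: "'a \<Rightarrow> 'a \<Rightarrow> 'a"
  szero :: 'a

definition semigroup0_iso :: "'a semigroup0 \<Rightarrow> 'b semigroup0 \<Rightarrow> ('a \<Rightarrow> 'b) \<Rightarrow> bool" where
  "semigroup0_iso T U h \<longleftrightarrow> bij_betw h (carrier T) (carrier U) \<and>
     (\<forall>x\<in>carrier T. \<forall>y\<in>carrier T. h (smult T x y) = smult U (h x) (h y))"

definition semigroup0_ideal :: "'a semigroup0 \<Rightarrow> 'a set \<Rightarrow> bool" where
  "semigroup0_ideal T J \<longleftrightarrow> J \<noteq> {} \<and> J \<subseteq> carrier T \<and>
     (\<forall>x\<in>carrier T. \<forall>y\<in>J. smult T x y \<in> J \<and> smult T y x \<in> J)"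

definition principal_ideal :: "'a semigroup0 \<Rightarrow> 'a \<Rightarrow> 'a semigroup0" where
  "principal_ideal T x = T\<lparr>carrier := \<Inter>{J. semigroup0_ideal T J \<and> x \<in> J}\<rparr>"

text \<open>In the Rees quotient \<open>G/I\<close> the class \<open>I\<close> is \<open>None\<close>, which serves as the zero \<open>\<theta>\<close>; for
  \<open>I = {}\<close> this is \<open>G\<close> with a zero adjoined.\<close>

definition rees_class :: "'a set \<Rightarrow> 'a \<Rightarrow> 'a option" where
  "rees_class I x = (if x \<in> I then None else Some x)"

definition rees_quotient :: "('a, 'm) monoid_scheme \<Rightarrow> 'a set \<Rightarrow> 'a option semigroup0" where
  "rees_quotient G I =
    \<lparr>carrier = insert None (Some ` (carrier G - I)),
     smult = (\<lambda>x y. case (x, y) of (Some a, Some b) \<Rightarrow> rees_class I (a \<otimes>\<^bsub>G\<^esub> b) | _ \<Rightarrow> None),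
     szero = None\<rparr>"

text \<open>The semigroup \<open>M\<^sup>0(S,A,B;P)\<close>, where \<open>S\<close> is a subsemigroup of the monoid \<open>G\<close> and the
  entries of \<open>P\<close> lie in \<open>S \<union> {1} \<union> {\<theta>}\<close>, with \<open>1\<close> the identity of \<open>G\<close>. Here \<open>None\<close> is \<open>\<theta>\<close>,
  both as an entry of \<open>P\<close> and as the zero of the semigroup.\<close>

definition matrix_semigroup ::
  "('s, 'm) monoid_scheme \<Rightarrow> 's set \<Rightarrow> 'a set \<Rightarrow> 'b set \<Rightarrow> ('b \<Rightarrow> 'a \<Rightarrow> 's option)
    \<Rightarrow> ('s \<times> 'a \<times> 'b) option semigroup0" where
  "matrix_semigroup G S A B P =
    \<lparr>carrier = insert None (Some ` (S \<times> A \<times> B)),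
     smult = (\<lambda>x y. case (x, y) of
        (Some (s, a, b), Some (t, a', b')) \<Rightarrow>
          (case P b a' of None \<Rightarrow> None | Some p \<Rightarrow> Some (s \<otimes>\<^bsub>G\<^esub> p \<otimes>\<^bsub>G\<^esub> t, a, b'))
      | _ \<Rightarrow> None),
     szero = None\<rparr>"


section \<open>The semigroups \<open>M\<^sub>i\<close> and their matrix form\<close>

definition M_ideal :: "nat \<Rightarrow> nat \<Rightarrow> nat list set option semigroup0" where
  "M_ideal n i =
     principal_ideal (rees_quotient (hk n) (I_ideal n i)) (rees_class (I_ideal n i) (s_elt n i))"

type_synonym hk_matrix = "nat list set \<Rightarrow> nat list set \<Rightarrow> nat list set option"

definition M_matrix ::
  "nat \<Rightarrow> nat \<Rightarrow> nat list set set \<Rightarrow> nat list set set \<Rightarrow> hk_matrix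
    \<Rightarrow> (nat list set \<times> nat list set \<times> nat list set) option semigroup0" where
  "M_matrix n i A B P = matrix_semigroup (hk n) (s_semigroup n i) A B P"

definition matrix_form :: "nat \<Rightarrow> nat \<Rightarrow> nat list set set \<Rightarrow> nat list set set \<Rightarrow> hk_matrix \<Rightarrow> bool" where
  "matrix_form n i A B P \<longleftrightarrow>
     finite A \<and> finite B \<and> A \<subseteq> carrier (hk n) \<and> B \<subseteq> carrier (hk n) \<and>
     \<one>\<^bsub>hk n\<^esub> \<in> A \<and> \<one>\<^bsub>hk n\<^esub> \<in> B \<and>
     card A = n choose (i + 1) \<and> card B = n choose (i + 1) \<and>
     (\<forall>b\<in>B. \<forall>a\<in>A. P b a \<in> insert None (Some ` s_monoid n i)) \<and>
     (\<forall>b\<in>B. \<forall>a\<in>A.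
        let y = rees_class (I_ideal n i) (s_elt n i \<otimes>\<^bsub>hk n\<^esub> b \<otimes>\<^bsub>hk n\<^esub> a \<otimes>\<^bsub>hk n\<^esub> s_elt n i) in
        (\<forall>m::nat. y = rees_class (I_ideal n i) (s_elt n i [^]\<^bsub>hk n\<^esub> (m + 2))
            \<longrightarrow> P b a = Some (s_elt n i [^]\<^bsub>hk n\<^esub> m)) \<and>
        (y = None \<longrightarrow> P b a = None)) \<and>
     semigroup0_iso (M_matrix n i A B P) (M_ideal n i)
       (\<lambda>x. case x of None \<Rightarrow> None
          | Some (t, a, b) \<Rightarrow> rees_class (I_ideal n i) (a \<otimes>\<^bsub>hk n\<^esub> t \<otimes>\<^bsub>hk n\<^esub> b))"

text \<open>The infinite cyclic group \<open>gr(s\<^sub>i)\<close> is \<^const>\<open>integer_group\<close>, with \<open>s\<^sub>i\<^sup>k\<close> written as the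
  integer \<open>k\<close>. The powers of \<open>s\<^sub>i\<close> in \<^term>\<open>hk n\<close> are pairwise distinct, so that the exponent
  below is well defined and embeds \<open>\<langle>s\<^sub>i\<rangle>\<close> into \<open>gr(s\<^sub>i)\<close>.\<close>

definition s_exponent :: "nat \<Rightarrow> nat \<Rightarrow> nat list set \<Rightarrow> int" where
  "s_exponent n i x = int (THE k. x = s_elt n i [^]\<^bsub>hk n\<^esub> k)"

definition M_gr ::
  "nat \<Rightarrow> nat \<Rightarrow> nat list set set \<Rightarrow> nat list set set \<Rightarrow> hk_matrix
    \<Rightarrow> (int \<times> nat list set \<times> nat list set) option semigroup0" where
  "M_gr n i A B P = matrix_semigroup integer_group (carrier integer_group) A B
     (\<lambda>b a. map_option (s_exponent n i) (P b a))"

definition M_incl ::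
  "nat \<Rightarrow> nat \<Rightarrow> (nat list set \<times> nat list set \<times> nat list set) option
    \<Rightarrow> (int \<times> nat list set \<times> nat list set) option" where
  "M_incl n i = map_option (\<lambda>(t, a, b). (s_exponent n i t, a, b))"


section \<open>Contracted semigroup algebras and their representations\<close>

text \<open>\<open>K\<^sub>0[T] = K[T]/K\<theta>\<close> has the nonzero elements of \<open>T\<close> as a basis over \<open>K\<close>; its elements are taken
  to be the finitely supported functions on \<open>T\<close> without \<open>\<theta>\<close>, and products equal to \<open>\<theta>\<close> vanish.\<close>

definition calg :: "'t semigroup0 \<Rightarrow> ('t \<Rightarrow> 'k::field) set" where
  "calg T = {f. finite {x. f x \<noteq> 0} \<and> {x. f x \<noteq> 0} \<subseteq> carrier T - {szero T}}"

definition calg_mult :: "'t semigroup0 \<Rightarrow> ('t \<Rightarrow> 'k::field) \<Rightarrow> ('t \<Rightarrow> 'k) \<Rightarrow> 't \<Rightarrow> 'k" where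
  "calg_mult T f g = (\<lambda>z. if z = szero T then 0
     else \<Sum>(x, y) \<in> {(x, y). f x \<noteq> 0 \<and> g y \<noteq> 0 \<and> smult T x y = z}. f x * g y)"

definition calg_elt :: "'t semigroup0 \<Rightarrow> 't \<Rightarrow> 't \<Rightarrow> 'k::field" where
  "calg_elt T x = (\<lambda>y. if y = x \<and> x \<noteq> szero T then 1 else 0)"

text \<open>For an injective \<open>h\<close> with \<open>h \<theta> = \<theta>\<close>, the linear map sending a basis element \<open>x\<close> to \<open>h x\<close>.\<close>

definition calg_map :: "('t \<Rightarrow> 'u) \<Rightarrow> ('t \<Rightarrow> 'k::field) \<Rightarrow> 'u \<Rightarrow> 'k" where
  "calg_map h f = (\<lambda>y. \<Sum>x \<in> {x. f x \<noteq> 0 \<and> h x = y}. f x)"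

text \<open>On the matrix type, \<open>*s\<close> multiplies rows by elements of \<^typ>\<open>'k^'r\<close>; this is multiplication
  by a scalar of \<open>K\<close>.\<close>

definition mat_scale :: "'k::field \<Rightarrow> 'k^'r^'r \<Rightarrow> 'k^'r^'r" where
  "mat_scale c A = (\<chi> p q. c * A $ p $ q)"

definition representation :: "'t semigroup0 \<Rightarrow> (('t \<Rightarrow> 'k::field) \<Rightarrow> 'k^'r^'r) \<Rightarrow> bool" where
  "representation T \<phi> \<longleftrightarrow>
     (\<forall>f\<in>calg T. \<forall>g\<in>calg T. \<phi> (\<lambda>x. f x + g x) = \<phi> f + \<phi> g) \<and>
     (\<forall>c. \<forall>f\<in>calg T. \<phi> (\<lambda>x. c * f x) = mat_scale c (\<phi> f)) \<and>
     (\<forall>f\<in>calg T. \<forall>g\<in>calg T. \<phi> (calg_mult T f g) = \<phi> f ** \<phi> g)"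

definition irreducible_representation ::
  "'t semigroup0 \<Rightarrow> (('t \<Rightarrow> 'k::field) \<Rightarrow> 'k^'r^'r) \<Rightarrow> bool" where
  "irreducible_representation T \<phi> \<longleftrightarrow> representation T \<phi> \<and>
     (\<exists>f\<in>calg T. \<phi> f \<noteq> 0) \<and>
     (\<forall>W. vec.subspace W \<and> (\<forall>f\<in>calg T. \<forall>w\<in>W. \<phi> f *v w \<in> W) \<longrightarrow> W = {0} \<or> W = UNIV)"

end

theory Submission
  imports Defs
begin

text \<open>Put \<open>x = (s\<^sub>i;1,1)\<close>. Since \<open>p\<^sub>1\<^sub>1 = 1\<close>, its powers are the elements \<open>(s\<^sub>i\<^sup>k;1,1)\<close>, and
  \<open>x M\<^sub>i x\<close> consists of \<open>\<theta>\<close> and powers of \<open>x\<close>. Let \<open>\<phi>\<close> be irreducible and write \<open>X = \<phi>(x)\<close>. The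
  triples with exponent at least three factor through \<open>x\<close>, so \<open>X = 0\<close> would make the algebra act
  nilpotently on a simple module; hence \<open>X \<noteq> 0\<close>. If \<open>w\<close> is a nonzero vector in the range of \<open>X\<close>, it
  generates the whole module, and applying \<open>X\<close> shows that the range of \<open>X\<close> is spanned by the vectors
  \<open>X\<^sup>k w\<close> with \<open>k \<ge> 1\<close> (\<open>range_corner_subset_span\<close>). Over an algebraically closed field \<open>w\<close> can be
  taken to be an eigenvector, so the range is a line on which \<open>X\<close> acts by a nonzero scalar \<open>c\<close>: thus
  \<open>X\<close> is \<open>c\<close> times an idempotent of rank one (\<open>corner_square_and_idempotent\<close>).

  For the extension, \<open>X\<^sup>2 = c X\<close> propagates to every position of the matrix semigroup:
  \<open>\<phi>(s\<^sub>i\<^sup>k\<^sup>+\<^sup>1;a,b) = c \<phi>(s\<^sub>i\<^sup>k;a,b)\<close> (\<open>E_shift\<close>). Hence \<open>\<phi>(s\<^sub>i\<^sup>k;a,b) = c\<^sup>k\<^sup>-\<^sup>1 \<phi>(s\<^sub>i;a,b)\<close>, and the same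
  formula with \<open>k\<close> an arbitrary integer defines the extension; it is irreducible because its image contains that
  of \<open>\<phi>\<close>. It is the only one: over \<open>gr(s\<^sub>i)\<close> each triple factors through \<open>x\<close> and through
  \<open>x\<^sup>2\<close>, so \<open>X\<^sup>2 = c X\<close> forces the formula (\<open>representation_gr_elt\<close>).

  The exponent of a power of \<open>s\<^sub>i\<close> is meaningful because these powers are distinct. This is seen by
  letting \<open>x\<^sub>j\<close> act on functions on the vertices of the cycle by replacing the value at \<open>j\<close> by one more
  than the value at the next vertex: a word containing every letter strictly increases the minimum.\<close>


section \<open>Monoids given by generators and relations\<close>

abbreviation word_class :: "'x set \<Rightarrow> ('x list \<times> 'x list) set \<Rightarrow> 'x list \<Rightarrow> 'x list set" where
  "word_class X R w \<equiv> pres_cong X R `` {w}"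

lemma pres_cong_in_lists:
  "(u, v) \<in> pres_cong X R \<Longrightarrow> u \<in> lists X \<and> v \<in> lists X"
  by (induction rule: pres_cong.induct) auto

lemma equiv_pres_cong: "equiv (lists X) (pres_cong X R)"
proof (rule equivI)
  show "pres_cong X R \<subseteq> lists X \<times> lists X"
    using pres_cong_in_lists by fastforce
  show "refl_on (lists X) (pres_cong X R)"
    by (rule refl_onI) (rule pres_cong.refl)
  show "sym (pres_cong X R)"
    by (rule symI) (rule pres_cong.sym)
  show "trans (pres_cong X R)"
    by (rule transI) (rule pres_cong.trans)
qed

lemma pres_cong_append:
  assumes "(u, u') \<in> pres_cong X R" "(v, v') \<in> pres_cong X R"
  shows "(u @ v, u' @ v') \<in> pres_cong X R"
proof (rule pres_cong.trans)
  show "(u @ v, u' @ v) \<in> pres_cong X R"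
    using pres_cong.ctxt[OF assms(1), of "[]" v] assms(2) pres_cong_in_lists by fastforce
  show "(u' @ v, u' @ v') \<in> pres_cong X R"
    using pres_cong.ctxt[OF assms(2), of u' "[]"] assms(1) pres_cong_in_lists by fastforce
qed

lemma presented_monoid_mult_class:
  assumes "u \<in> lists X" "v \<in> lists X"
  shows "word_class X R u \<otimes>\<^bsub>presented_monoid X R\<^esub> word_class X R v = word_class X R (u @ v)"
proof -
  have eq: "word_class X R (u' @ v') = word_class X R (u @ v)"
    if "u' \<in> word_class X R u" "v' \<in> word_class X R v" for u' v'
  proof -
    have "(u @ v, u' @ v') \<in> pres_cong X R"
      using that by (intro pres_cong_append) auto
    then show ?thesis
      using equiv_class_eq[OF equiv_pres_cong] by metis
  qed
  moreover have "u \<in> word_class X R u" "v \<in> word_class X R v"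
    using assms by (auto intro: pres_cong.refl)
  ultimately have "(\<Union>u'\<in>word_class X R u. \<Union>v'\<in>word_class X R v. word_class X R (u' @ v'))
      = word_class X R (u @ v)"
    by (metis (no_types, lifting) SUP_eq_const empty_iff eq)
  then show ?thesis
    by (simp add: presented_monoid_def)
qed

lemma presented_monoid_carrier:
  "x \<in> carrier (presented_monoid X R) \<longleftrightarrow> (\<exists>w\<in>lists X. x = word_class X R w)"
  by (auto simp: presented_monoid_def quotient_def)

lemma presented_monoid_one: "\<one>\<^bsub>presented_monoid X R\<^esub> = word_class X R []"
  by (simp add: presented_monoid_def)

lemma monoid_presented_monoid: "Group.monoid (presented_monoid X R)"
proof
  fix x y z
  assume "x \<in> carrier (presented_monoid X R)" "y \<in> carrier (presented_monoid X R)"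
    "z \<in> carrier (presented_monoid X R)"
  then obtain u v w where w: "u \<in> lists X" "v \<in> lists X" "w \<in> lists X"
    and eq: "x = word_class X R u" "y = word_class X R v" "z = word_class X R w"
    unfolding presented_monoid_carrier by blast
  show "x \<otimes>\<^bsub>presented_monoid X R\<^esub> y \<in> carrier (presented_monoid X R)"
    unfolding presented_monoid_carrier using w
    by (auto simp: eq presented_monoid_mult_class intro!: bexI[of _ "u @ v"])
  show "x \<otimes>\<^bsub>presented_monoid X R\<^esub> y \<otimes>\<^bsub>presented_monoid X R\<^esub> z
      = x \<otimes>\<^bsub>presented_monoid X R\<^esub> (y \<otimes>\<^bsub>presented_monoid X R\<^esub> z)"
    using w presented_monoid_mult_class[of "u @ v" X w R] presented_monoid_mult_class[of u X "v @ w" R]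
    by (simp add: eq presented_monoid_mult_class)
next
  show "\<one>\<^bsub>presented_monoid X R\<^esub> \<in> carrier (presented_monoid X R)"
    unfolding presented_monoid_carrier presented_monoid_one by (rule bexI[of _ "[]"]) auto
next
  fix x assume "x \<in> carrier (presented_monoid X R)"
  then obtain u where "u \<in> lists X" "x = word_class X R u"
    unfolding presented_monoid_carrier by blast
  then show "\<one>\<^bsub>presented_monoid X R\<^esub> \<otimes>\<^bsub>presented_monoid X R\<^esub> x = x"
    "x \<otimes>\<^bsub>presented_monoid X R\<^esub> \<one>\<^bsub>presented_monoid X R\<^esub> = x"
    unfolding presented_monoid_one
    using presented_monoid_mult_class[of "[]" X u R] presented_monoid_mult_class[of u X "[]" R]
    by simp_all
qed

lemma presented_monoid_pow_class:
  assumes "w \<in> lists X"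
  shows "word_class X R w [^]\<^bsub>presented_monoid X R\<^esub> (k::nat)
    = word_class X R (concat (replicate k w))"
proof (induction k)
  case 0
  show ?case by (simp add: presented_monoid_one)
next
  case (Suc k)
  have "concat (replicate k w) \<in> lists X"
    using assms by (induction k) auto
  moreover have "concat (replicate k w) @ w = w @ concat (replicate k w)"
    by (induction k) auto
  ultimately show ?case
    using Suc assms by (simp add: presented_monoid_mult_class)
qed


section \<open>The powers of \<open>s\<^sub>i\<close> are distinct\<close>

definition next_vertex :: "nat \<Rightarrow> nat \<Rightarrow> nat" where
  "next_vertex n j = (if j = n then 1 else j + 1)"

text \<open>The assignment \<open>v\<^sub>j := v\<^sub>j\<^sub>+\<^sub>1 + 1\<close>, with the index taken on the cycle. It reads one coordinate and
  overwrites another, so assignments at vertices without an arrow between them commute. For an arrow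
  \<open>i \<rightarrow> j\<close>, both \<open>x\<^sub>i x\<^sub>j x\<^sub>i\<close> and \<open>x\<^sub>j x\<^sub>i x\<^sub>j\<close> act as \<open>x\<^sub>i x\<^sub>j\<close>, the rightmost letter acting first. In
  \<open>x\<^sub>i x\<^sub>j x\<^sub>i\<close> the first value written at \<open>i\<close> is overwritten unread; in \<open>x\<^sub>j x\<^sub>i x\<^sub>j\<close> the second
  assignment at \<open>j\<close> repeats the first, because its source is not \<open>i\<close> when the cycle has at least three vertices.\<close>

definition letter_action :: "nat \<Rightarrow> nat \<Rightarrow> (nat \<Rightarrow> nat) \<Rightarrow> nat \<Rightarrow> nat" where
  "letter_action n j v = v(j := v (next_vertex n j) + 1)"

abbreviation word_action :: "nat \<Rightarrow> nat list \<Rightarrow> (nat \<Rightarrow> nat) \<Rightarrow> nat \<Rightarrow> nat" where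
  "word_action n w \<equiv> foldr (letter_action n) w"

lemma word_action_hk_rels:
  assumes "n \<ge> 3" "(u, v) \<in> hk_rels n"
  shows "word_action n u = word_action n v"
  using assms
  by (auto simp: hk_rels_def cycle_arrow_def letter_action_def next_vertex_def fun_eq_iff
      split: if_splits)

lemma word_action_pres_cong:
  assumes "(u, v) \<in> pres_cong {1..n} (hk_rels n)" "n \<ge> 3"
  shows "word_action n u = word_action n v"
  using assms by (induction rule: pres_cong.induct) (auto simp: word_action_hk_rels)

text \<open>Each coordinate named by a letter is set to one above the current value of the next coordinate,
  so a common lower bound persists and becomes strict there.\<close>

lemma word_action_ge:
  assumes "set w \<subseteq> {1..n}" "n \<ge> 1" "\<forall>j\<in>{1..n}. m \<le> v j"
  shows "\<forall>j\<in>{1..n}. m \<le> word_action n w v j \<and> (j \<in> set w \<longrightarrow> m < word_action n w v j)"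
  using assms
proof (induction w)
  case (Cons x w)
  have "next_vertex n x \<in> {1..n}"
    using Cons.prems by (auto simp: next_vertex_def)
  moreover have IH: "\<forall>j\<in>{1..n}. m \<le> word_action n w v j \<and> (j \<in> set w \<longrightarrow> m < word_action n w v j)"
    using Cons by auto
  ultimately have "m \<le> word_action n w v (next_vertex n x)"
    by blast
  then have "m < word_action n (x # w) v x"
    by (simp add: letter_action_def)
  moreover have "word_action n (x # w) v j = word_action n w v j" if "j \<noteq> x" for j
    using that by (simp add: letter_action_def)
  ultimately show ?case
    using IH by (metis less_imp_le_nat set_ConsD)
qed auto

lemma word_action_power_ge:
  assumes "set w = {1..n}" "n \<ge> 1" "\<forall>j\<in>{1..n}. m \<le> v j"
  shows "\<forall>j\<in>{1..n}. m + k \<le> word_action n (concat (replicate k w)) v j"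
proof (induction k)
  case (Suc k)
  then show ?case
    using word_action_ge[of w n "m + k" "word_action n (concat (replicate k w)) v"] assms
    by auto
qed (use assms in simp)

text \<open>If two powers coincided, the action of \<open>w\<^sup>l\<^sup>-\<^sup>k\<close> would have a fixed point, contradicting that the
  minimal coordinate grows under every full word.\<close>

lemma hk_pow_inj:
  assumes n: "n \<ge> 3" and w: "set w = {1..n}"
    and eq: "hk_word n w [^]\<^bsub>hk n\<^esub> (k::nat) = hk_word n w [^]\<^bsub>hk n\<^esub> (l::nat)"
  shows "k = l"
proof -
  have False if "k < l"
    and eq: "hk_word n w [^]\<^bsub>hk n\<^esub> k = hk_word n w [^]\<^bsub>hk n\<^esub> l" for k l :: nat
  proof -
    let ?act = "\<lambda>k. word_action n (concat (replicate k w))"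
    have lst: "concat (replicate k w) \<in> lists {1..n}" for k
      using w by (induction k) auto
    have "w \<in> lists {1..n}" using w by auto
    then have "(concat (replicate k w), concat (replicate l w)) \<in> pres_cong {1..n} (hk_rels n)"
      using eq lst by (simp add: hk_def hk_word_def presented_monoid_pow_class
          eq_equiv_class_iff[OF equiv_pres_cong])
    then have "?act k = ?act l"
      using n by (rule word_action_pres_cong)
    define v where "v = ?act k (\<lambda>_. 0)"
    have "concat (replicate l w) = concat (replicate (l - k) w) @ concat (replicate k w)"
      using \<open>k < l\<close> by (simp flip: concat_append replicate_add)
    then have "?act l (\<lambda>_. 0) = ?act (l - k) v"
      unfolding v_def by (simp only: foldr_append o_apply)
    then have fixed: "?act (l - k) v = v"
      unfolding \<open>?act k = ?act l\<close>[symmetric] v_def[symmetric] ..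
    \<comment> \<open>The lower bound is violated at a vertex where the fixed point is minimal.\<close>
    define m where "m = Min (v ` {1..n})"
    have "m \<in> v ` {1..n}"
      unfolding m_def using n by (intro Min_in) auto
    then obtain j where j: "j \<in> {1..n}" "v j = m" by (elim imageE) simp
    have "\<forall>j\<in>{1..n}. m \<le> v j"
      unfolding m_def by simp
    then have "m + (l - k) \<le> ?act (l - k) v j"
      using word_action_power_ge[of w n m v "l - k"] w n j(1) by simp
    then show False
      using fixed j(2) \<open>k < l\<close> by simp
  qed
  then show ?thesis
    using eq by (metis linorder_neqE_nat)
qed

lemma s_elt_pow_inj:
  assumes "n \<ge> 3" "i \<le> n - 2" "s_elt n i [^]\<^bsub>hk n\<^esub> (k::nat) = s_elt n i [^]\<^bsub>hk n\<^esub> (l::nat)"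
  shows "k = l"
proof (rule hk_pow_inj[OF assms(1) _ assms(3)[unfolded s_elt_def]])
  show "set ([n] @ [1..<i + 1] @ rev [i + 1..<n]) = {1..n}"
    using assms(1,2) by (simp add: set_eq_iff) linarith
qed

lemma s_exponent_pow:
  assumes "n \<ge> 3" "i \<le> n - 2"
  shows "s_exponent n i (s_elt n i [^]\<^bsub>hk n\<^esub> (k::nat)) = int k"
  unfolding s_exponent_def using s_elt_pow_inj[OF assms] by (auto intro!: the_equality)

lemma monoid_hk: "Group.monoid (hk n)"
  unfolding hk_def by (rule monoid_presented_monoid)

lemma s_elt_carrier:
  assumes "n \<ge> 3" "i \<le> n - 2"
  shows "s_elt n i \<in> carrier (hk n)"
proof -
  have "[n] @ [1..<i + 1] @ rev [i + 1..<n] \<in> lists {1..n}"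
    using assms by auto
  then show ?thesis
    unfolding s_elt_def hk_word_def hk_def presented_monoid_carrier by blast
qed

lemma matrix_form_entry:
  assumes "matrix_form n i A B P" "b \<in> B" "a \<in> A"
  obtains "P b a = None" | m :: nat where "P b a = Some (s_elt n i [^]\<^bsub>hk n\<^esub> m)"
proof -
  have "P b a \<in> insert None (Some ` s_monoid n i)"
    using assms unfolding matrix_form_def by blast
  then show ?thesis
    using that unfolding s_monoid_def by blast
qed

text \<open>The entry at \<open>(1,1)\<close> is determined by \<open>s\<^sub>i 1 1 s\<^sub>i = s\<^sub>i\<^sup>0\<^sup>+\<^sup>2\<close>.\<close>

lemma matrix_form_entry_one:
  assumes "n \<ge> 3" "i \<le> n - 2" "matrix_form n i A B P"
  shows "P \<one>\<^bsub>hk n\<^esub> \<one>\<^bsub>hk n\<^esub> = Some \<one>\<^bsub>hk n\<^esub>"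
proof -
  interpret Group.monoid "hk n" by (rule monoid_hk)
  have "s_elt n i \<otimes>\<^bsub>hk n\<^esub> \<one>\<^bsub>hk n\<^esub> \<otimes>\<^bsub>hk n\<^esub> \<one>\<^bsub>hk n\<^esub> \<otimes>\<^bsub>hk n\<^esub> s_elt n i
      = s_elt n i [^]\<^bsub>hk n\<^esub> (0 + 2 :: nat)"
    using s_elt_carrier[OF assms(1,2)] by (simp add: numeral_2_eq_2)
  then have "P \<one>\<^bsub>hk n\<^esub> \<one>\<^bsub>hk n\<^esub> = Some (s_elt n i [^]\<^bsub>hk n\<^esub> (0::nat))"
    using assms(3) unfolding matrix_form_def Let_def by metis
  then show ?thesis by simp
qed


section \<open>Eigenvectors and matrices of rank one\<close>

lemma mat_scale_vector: "mat_scale c M *v v = c *s (M *v v)"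
  by (simp add: mat_scale_def matrix_vector_mult_def vec_eq_iff sum_distrib_left mult.assoc)

lemma mat_scale_scale: "mat_scale c (mat_scale d M) = mat_scale (c * d) M"
  by (simp add: mat_scale_def mult.assoc)

lemma mat_scale_one [simp]: "mat_scale 1 M = M"
  by (simp add: mat_scale_def)

lemma mat_scale_zero [simp]: "mat_scale 0 M = 0" "mat_scale c 0 = 0"
  by (simp_all add: mat_scale_def vec_eq_iff)

lemma mat_scale_add: "mat_scale (c + d) M = mat_scale c M + mat_scale d M"
  by (simp add: mat_scale_def vec_eq_iff distrib_right)

lemma mat_scale_sum: "mat_scale (\<Sum>j\<in>J. c j) M = (\<Sum>j\<in>J. mat_scale (c j) M)"
  by (induction J rule: infinite_finite_induct) (simp_all add: mat_scale_add)

lemma mat_scale_sum_right: "mat_scale c (\<Sum>j\<in>J. M j) = (\<Sum>j\<in>J. mat_scale c (M j))"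
  by (induction J rule: infinite_finite_induct)
    (simp_all add: mat_scale_def vec_eq_iff distrib_left)

lemma mat_scale_mult:
  fixes M N :: "'k::field^'r^'r"
  shows "mat_scale c M ** mat_scale d N = mat_scale (c * d) (M ** N)"
  by (simp add: matrix_eq mat_scale_vector vec.scale flip: matrix_vector_mul_assoc)

lemma matrix_mult_zero [simp]:
  fixes M :: "'k::field^'r^'r"
  shows "0 ** M = 0" "M ** 0 = 0"
  by (simp_all add: matrix_eq flip: matrix_vector_mul_assoc)

lemma matrix_sum_mult_sum:
  fixes M :: "'i \<Rightarrow> 'k::field^'r^'r" and N :: "'j \<Rightarrow> 'k^'r^'r"
  shows "(\<Sum>i\<in>I. M i) ** (\<Sum>j\<in>J. N j) = (\<Sum>(i, j)\<in>I \<times> J. M i ** N j)"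
proof -
  have left: "(\<Sum>i\<in>I. M i) ** L = (\<Sum>i\<in>I. M i ** L)" for L :: "'k^'r^'r"
    by (induction I rule: infinite_finite_induct)
      (simp_all add: matrix_eq matrix_vector_mult_add_rdistrib flip: matrix_vector_mul_assoc)
  have right: "L ** (\<Sum>j\<in>J. N j) = (\<Sum>j\<in>J. L ** N j)" for L :: "'k^'r^'r"
    by (induction J rule: infinite_finite_induct) (simp_all add: matrix_add_ldistrib)
  show ?thesis
    unfolding left unfolding right sum.cartesian_product ..
qed

text \<open>Such a matrix is an outer product \<open>w r\<^sup>T\<close>, so its rows are multiples of \<open>r\<close>.\<close>

lemma rank_eq_1_if_range_in_line:
  fixes M :: "'k::field^'r^'r"
  assumes "M \<noteq> 0" and ex: "\<And>v. \<exists>d. M *v v = d *s w"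
  shows "rank M = 1"
proof -
  obtain d where d: "\<And>v. M *v v = d v *s w" using ex by metis
  define r :: "'k^'r" where "r = (\<chi> j. d (axis j 1))"
  have "M $ p $ j = w $ p * r $ j" for p j
    using arg_cong[OF d[of "axis j 1"], of "\<lambda>u. u $ p"]
    by (simp add: r_def mult.commute[of _ "d _"] matrix_vector_mult_def axis_def if_distrib
        cong: if_cong)
  then have "row p M = w $ p *s r" for p
    by (simp add: row_def vec_eq_iff)
  then have sub: "rows M \<subseteq> vec.span {r}"
    by (auto simp: rows_def vec.span_singleton)
  then have "rank M \<le> 1"
    unfolding row_rank_def_gen using vec.dim_le_card[of "rows M" "{r}"] by simp
  moreover have "rank M \<noteq> 0"
  proof
    assume "rank M = 0"
    then have "rows M \<subseteq> {0}" unfolding row_rank_def_gen by simp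
    then have "row p M = 0" for p unfolding rows_def by blast
    then have "M = 0" by (simp add: row_def vec_eq_iff)
    then show False using assms(1) by simp
  qed
  ultimately show ?thesis by simp
qed

definition poly_apply :: "'k::field poly \<Rightarrow> 'k^'r^'r \<Rightarrow> 'k^'r \<Rightarrow> 'k^'r" where
  "poly_apply p M v = (\<Sum>k\<le>degree p. coeff p k *s (((*v) M ^^ k) v))"

lemma poly_apply_ge:
  assumes "degree p \<le> d"
  shows "poly_apply p M v = (\<Sum>k\<le>d. coeff p k *s (((*v) M ^^ k) v))"
  unfolding poly_apply_def
  by (rule sum.mono_neutral_left) (use assms in \<open>auto simp: coeff_eq_0\<close>)

lemma matrix_power_commute:
  "((*v) M ^^ k) (M *v v) = M *v (((*v) M ^^ k) v)"
  by (simp add: funpow_swap1)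

lemma matrix_power_diff:
  fixes M :: "'k::field^'r^'r"
  shows "((*v) M ^^ k) (u - c *s v) = ((*v) M ^^ k) u - c *s (((*v) M ^^ k) v)"
  by (induction k) (simp_all add: vec.diff vec.scale)

text \<open>The linear factor of \<open>p(M)\<close> is applied first, so that a linear factor can be split off a
  polynomial that annihilates \<open>v\<close> by changing \<open>v\<close>.\<close>

lemma poly_apply_factor:
  fixes M :: "'k::field^'r^'r"
  shows "poly_apply ([:-c, 1:] * q) M v = poly_apply q M (M *v v - c *s v)"
proof -
  let ?d = "degree q"
  let ?F = "\<lambda>k. ((*v) M ^^ k) v"
  have "degree ([:-c, 1:] * q) \<le> Suc ?d"
    using degree_mult_le[of "[:-c, 1:]" q] by simp
  then have "poly_apply ([:-c, 1:] * q) M v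
      = (\<Sum>k\<le>Suc ?d. coeff (pCons 0 q) k *s ?F k) - (\<Sum>k\<le>Suc ?d. (c * coeff q k) *s ?F k)"
    by (simp add: poly_apply_ge vec.scale_left_diff_distrib sum_subtractf[symmetric]
        del: sum.atMost_Suc)
  also have "(\<Sum>k\<le>Suc ?d. coeff (pCons 0 q) k *s ?F k) = (\<Sum>k\<le>?d. coeff q k *s ?F (Suc k))"
    by (simp add: sum.atMost_Suc_shift del: sum.atMost_Suc)
  also have "(\<Sum>k\<le>Suc ?d. (c * coeff q k) *s ?F k) = (\<Sum>k\<le>?d. (c * coeff q k) *s ?F k)"
    by (simp add: coeff_eq_0)
  also have "(\<Sum>k\<le>?d. coeff q k *s ?F (Suc k)) - (\<Sum>k\<le>?d. (c * coeff q k) *s ?F k)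
      = poly_apply q M (M *v v - c *s v)"
    by (simp add: poly_apply_def matrix_power_diff matrix_power_commute sum_subtractf[symmetric]
        vec.scale_right_diff_distrib mult.commute)
  finally show ?thesis .
qed

text \<open>The vectors \<open>v, M v, \<dots>, M\<^sup>r v\<close> are too many to be independent in dimension \<open>r\<close>. Either two of
  them are equal or they form a dependent set, and the relation gives the coefficients.\<close>

lemma exists_annihilating_poly:
  fixes M :: "'k::field^'r^'r" and v :: "'k^'r"
  obtains p where "p \<noteq> 0" "poly_apply p M v = 0"
proof -
  let ?d = "CARD('r)"
  let ?F = "\<lambda>k. ((*v) M ^^ k) v"
  show ?thesis
  proof (cases "inj_on ?F {..?d}")
    case True
    have "vec.dependent (?F ` {..?d})"
    proof (rule ccontr)
      assume "vec.independent (?F ` {..?d})"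
      then have "card (?F ` {..?d}) \<le> ?d"
        using vec.independent_card_le_dim[of "?F ` {..?d}" UNIV] by (simp add: card_cart_basis)
      then show False using True by (simp add: card_image)
    qed
    then obtain u where u: "(\<Sum>x\<in>?F ` {..?d}. u x *s x) = 0" "\<exists>x\<in>?F ` {..?d}. u x \<noteq> 0"
      by (auto simp: vec.dependent_finite)
    define p where "p = (\<Sum>k\<le>?d. monom (u (?F k)) k)"
    have cf: "coeff p k = (if k \<le> ?d then u (?F k) else 0)" for k
      by (simp add: p_def coeff_sum)
    have "p \<noteq> 0"
      using u(2) cf by (metis (no_types, lifting) atMost_iff coeff_0 imageE)
    moreover have "degree p \<le> ?d"
      by (rule degree_le) (simp add: cf)
    then have "poly_apply p M v = (\<Sum>k\<le>?d. u (?F k) *s ?F k)"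
      by (simp add: poly_apply_ge cf)
    then have "poly_apply p M v = 0"
      using u(1) by (simp add: sum.reindex[OF True])
    ultimately show ?thesis by (rule that)
  next
    case False
    then obtain k l where kl: "k \<noteq> l" "?F k = ?F l" by (auto simp: inj_on_def)
    define p :: "'k poly" where "p = monom 1 k - monom 1 l"
    have "coeff p k = 1" using kl by (simp add: p_def)
    then have "p \<noteq> 0" by auto
    moreover have "degree p \<le> max k l"
      unfolding p_def by (rule degree_diff_le) (auto simp: degree_monom_eq)
    then have "poly_apply p M v
        = (\<Sum>j\<le>max k l. (if j = k then ?F j else 0) - (if j = l then ?F j else 0))"
      by (subst poly_apply_ge) (auto simp: p_def vec.scale_left_diff_distrib intro!: sum.cong)
    then have "poly_apply p M v = 0"
      using kl by (simp add: sum_subtractf)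
    ultimately show ?thesis by (rule that)
  qed
qed

text \<open>Linear factors of an annihilating polynomial of \<open>v\<close> are applied to \<open>v\<close> one after the other: just
  before the first of them that gives zero, the vector is an eigenvector, and it has stayed in \<open>U\<close>. The
  eigenvector is needed in a given invariant subspace because \<open>M\<close> may have a kernel outside it.\<close>

lemma exists_eigenvector:
  fixes M :: "'k::alg_closed_field^'r^'r"
  assumes U: "vec.subspace U" "\<And>u. u \<in> U \<Longrightarrow> M *v u \<in> U"
    and v: "v \<in> U" "v \<noteq> 0"
  obtains c w where "w \<in> U" "w \<noteq> 0" "M *v w = c *s w"
proof -
  obtain p where p: "p \<noteq> 0" "poly_apply p M v = 0"
    by (rule exists_annihilating_poly)
  then have "\<exists>c w. w \<in> U \<and> w \<noteq> 0 \<and> M *v w = c *s w"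
    using v
  proof (induction "degree p" arbitrary: p v)
    case 0
    then obtain a where "p = [:a:]" "a \<noteq> 0"
      by (metis degree_eq_zeroE pCons_eq_0_iff)
    then have False using 0 by (simp add: poly_apply_def)
    then show ?case ..
  next
    case (Suc d)
    then obtain c where "poly p c = 0"
      using alg_closed_imp_poly_has_root[of p] by auto
    then obtain q where q: "p = [:-c, 1:] * q"
      by (meson dvdE poly_eq_0_iff_dvd)
    with \<open>p \<noteq> 0\<close> have "q \<noteq> 0" by auto
    then have "degree p = Suc (degree q)"
      by (subst q, subst degree_mult_eq) auto
    show ?case
    proof (cases "M *v v - c *s v = 0")
      case True
      then show ?thesis using Suc.prems by auto
    next
      case False
      moreover have "M *v v - c *s v \<in> U"
        using U Suc.prems by (auto intro!: vec.subspace_diff vec.subspace_scale)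
      moreover have "poly_apply q M (M *v v - c *s v) = 0"
        using Suc.prems(2) poly_apply_factor[of c q M v] by (simp only: q)
      ultimately show ?thesis
        using Suc.hyps(1)[of q "M *v v - c *s v"] Suc.hyps(2) \<open>degree p = Suc (degree q)\<close>
          \<open>q \<noteq> 0\<close> by simp
    qed
  qed
  then show ?thesis using that by blast
qed

section \<open>Irreducible families of matrices\<close>

text \<open>The images \<open>E k a b\<close> of the triples \<open>(s\<^sup>k;a,b)\<close>, \<open>k \<ge> 1\<close>, under an irreducible representation of a
  semigroup of matrix type over the positive powers of \<open>s\<close>; \<open>q b a\<close> is the exponent of the entry
  \<open>p\<^sub>b\<^sub>a\<close>, and \<open>None\<close> stands for a zero entry. The indices \<open>a0\<close>, \<open>b0\<close> are those
  of an entry \<open>1\<close>. Exponents are natural numbers here, so that the linear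
  algebra is independent of how \<open>s\<close> is realized.\<close>

locale irreducible_matrix_family =
  fixes E :: "nat \<Rightarrow> 'a \<Rightarrow> 'b \<Rightarrow> 'k::alg_closed_field^'r::finite^'r"
    and A :: "'a set" and B :: "'b set" and q :: "'b \<Rightarrow> 'a \<Rightarrow> nat option"
    and a0 :: 'a and b0 :: 'b
  assumes mult: "\<lbrakk>1 \<le> k; 1 \<le> l; a \<in> A; a' \<in> A; b \<in> B; b' \<in> B\<rbrakk> \<Longrightarrow>
      E k a b ** E l a' b' = (case q b a' of None \<Rightarrow> 0 | Some m \<Rightarrow> E (k + m + l) a b')"
    and base: "a0 \<in> A" "b0 \<in> B" "q b0 a0 = Some 0"
    and nonzero: "\<exists>k a b. 1 \<le> k \<and> a \<in> A \<and> b \<in> B \<and> E k a b \<noteq> 0"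
    and simple: "\<lbrakk>vec.subspace W; \<And>k a b w. \<lbrakk>1 \<le> k; a \<in> A; b \<in> B; w \<in> W\<rbrakk> \<Longrightarrow> E k a b *v w \<in> W\<rbrakk>
      \<Longrightarrow> W = {0} \<or> W = UNIV"
begin

definition family :: "('k^'r^'r) set" where
  "family = {E k a b | k a b. 1 \<le> k \<and> a \<in> A \<and> b \<in> B}"

definition corner :: "'k^'r^'r" where
  "corner = E 1 a0 b0"

lemma family_mult_cases:
  assumes "M \<in> family" "N \<in> family"
  shows "M ** N = 0 \<or> (\<exists>k a b. 2 \<le> k \<and> a \<in> A \<and> b \<in> B \<and> M ** N = E k a b)"
proof -
  obtain k a b l a' b' where eqs: "1 \<le> k" "1 \<le> l" "a \<in> A" "a' \<in> A" "b \<in> B" "b' \<in> B"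
    "M = E k a b" "N = E l a' b'"
    using assms unfolding family_def by blast
  then show ?thesis
  proof (cases "q b a'")
    case (Some m)
    have "M ** N = E (k + m + l) a b'"
      using Some mult[of k l a a' b b'] eqs by simp
    moreover have "2 \<le> k + m + l"
      using eqs by simp
    ultimately show ?thesis
      using eqs by blast
  qed (use mult[of k l a a' b b'] eqs in simp)
qed

lemma family_mult: "M \<in> family \<Longrightarrow> N \<in> family \<Longrightarrow> M ** N = 0 \<or> M ** N \<in> family"
  using family_mult_cases[of M N] unfolding family_def by fastforce

text \<open>The vectors killed by the whole family form an invariant subspace, and it is not everything
  because some matrix of the family is nonzero.\<close>

lemma annihilated_eq_zero:
  assumes "\<And>M. M \<in> family \<Longrightarrow> M *v v = 0"
  shows "v = 0"
proof -
  let ?W = "{v. \<forall>M\<in>family. M *v v = 0}"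
  have "vec.subspace ?W"
    by (rule vec.subspaceI) (auto simp: vec.add vec.scale)
  moreover have "E k a b *v w \<in> ?W" if "1 \<le> k" "a \<in> A" "b \<in> B" "w \<in> ?W" for k a b w
  proof -
    have "E k a b *v w = 0"
      using that unfolding family_def by blast
    then show ?thesis by simp
  qed
  ultimately have "?W = {0} \<or> ?W = UNIV"
    by (rule simple)
  moreover have "?W \<noteq> UNIV"
  proof
    assume UNIV: "?W = UNIV"
    obtain k a b where kab: "1 \<le> k" "a \<in> A" "b \<in> B" "E k a b \<noteq> 0"
      using nonzero by blast
    have "E k a b *v w = 0" for w
    proof -
      have "w \<in> ?W" using UNIV by simp
      then show ?thesis using kab(1-3) unfolding family_def by blast
    qed
    then show False using kab(4) by (simp add: matrix_eq)
  qed
  moreover have "v \<in> ?W" using assms by simp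
  ultimately show ?thesis by blast
qed

lemma span_orbit:
  assumes "v \<noteq> 0"
  shows "vec.span {M *v v | M. M \<in> family} = UNIV"
proof -
  let ?S = "{M *v v | M. M \<in> family}"
  have "E k a b *v w \<in> vec.span ?S" if "1 \<le> k" "a \<in> A" "b \<in> B" "w \<in> vec.span ?S" for k a b w
    using that(4)
  proof (induction rule: vec.span_induct_alt)
    case (step c y z)
    then obtain M where M: "M \<in> family" "y = M *v v" by blast
    have "E k a b \<in> family" using that(1-3) unfolding family_def by blast
    then have "E k a b ** M = 0 \<or> E k a b ** M \<in> family" using M(1) by (rule family_mult)
    then have "E k a b *v y \<in> vec.span ?S"
      by (auto simp: M(2) matrix_vector_mul_assoc vec.span_zero intro: vec.span_base)
    then show ?case
      using step(2) by (simp add: vec.add vec.scale vec.span_add vec.span_scale)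
  qed (simp add: vec.span_zero)
  then have "vec.span ?S = {0} \<or> vec.span ?S = UNIV"
    by (rule simple[OF vec.subspace_span])
  moreover have "vec.span ?S \<noteq> {0}"
  proof
    assume "vec.span ?S = {0}"
    then have "M *v v = 0" if "M \<in> family" for M
      using that vec.span_base[of "M *v v" ?S] by blast
    then show False using annihilated_eq_zero assms by blast
  qed
  ultimately show ?thesis by blast
qed

lemma E_Suc_base: "1 \<le> k \<Longrightarrow> E (Suc k) a0 b0 = E k a0 b0 ** corner"
  using mult[of k 1 a0 a0 b0 b0] base by (simp add: corner_def)

text \<open>Three factors with exponents at least one are needed, hence the bound on \<open>k\<close>. Smaller exponents
  are reached only after multiplying by elements of the family, which is what the next lemma is for.\<close>

lemma E_factor_through_corner:
  assumes "3 \<le> k" "a \<in> A" "b \<in> B"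
  shows "E k a b = E 1 a b0 ** corner ** E (k - 2) a0 b"
proof -
  have "E 1 a b0 ** corner = E 2 a b0"
    using assms base mult[of 1 1 a a0 b0 b0] by (simp add: corner_def numeral_2_eq_2)
  moreover have "2 + 0 + (k - 2) = k"
    using assms by simp
  then have "E 2 a b0 ** E (k - 2) a0 b = E k a b"
    using assms base mult[of 2 "k - 2" a a0 b0 b] by simp
  ultimately show ?thesis by simp
qed

text \<open>Two applications of \<open>annihilated_eq_zero\<close> to the vectors \<open>F *v v\<close>. Multiplying by
  two members raises exponents to at least three.\<close>

lemma matrix_eq_zeroI:
  assumes "\<And>M N. M \<in> family \<Longrightarrow> N \<in> family \<Longrightarrow> M ** (N ** F) = 0"
  shows "F = (0 :: 'k^'r^'r)"
proof -
  have "F *v v = 0" for v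
  proof (rule annihilated_eq_zero, rule annihilated_eq_zero)
    fix M N assume "M \<in> family" "N \<in> family"
    then show "N *v (M *v (F *v v)) = 0"
      using assms[of N M] by (simp add: matrix_vector_mul_assoc matrix_mul_assoc)
  qed
  then show ?thesis by (simp add: matrix_eq)
qed

text \<open>Otherwise all matrices with exponent at least three vanish, hence all products of three members
  of the family, which is impossible on a simple module.\<close>

lemma corner_nonzero: "corner \<noteq> 0"
proof
  assume "corner = 0"
  then have E0: "E k a b = 0" if "3 \<le> k" "a \<in> A" "b \<in> B" for k a b
    using E_factor_through_corner[OF that] by (simp add: matrix_eq flip: matrix_vector_mul_assoc)
  have "F = 0" if F: "F \<in> family" for F
  proof (rule matrix_eq_zeroI)
    fix M N assume M: "M \<in> family" "N \<in> family"
    obtain k a b where M': "M = E k a b" "1 \<le> k" "a \<in> A" "b \<in> B"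
      using M(1) unfolding family_def by blast
    show "M ** (N ** F) = 0"
      using family_mult_cases[OF M(2) F]
    proof
      assume "N ** F = 0"
      then show ?thesis by (simp add: matrix_eq flip: matrix_vector_mul_assoc)
    next
      assume "\<exists>k a b. 2 \<le> k \<and> a \<in> A \<and> b \<in> B \<and> N ** F = E k a b"
      then obtain l a' b' where "2 \<le> l" "a' \<in> A" "b' \<in> B" "N ** F = E l a' b'" by blast
      then show ?thesis
        using M' mult[of k l a a' b b'] E0 by (cases "q b a'") auto
    qed
  qed
  then show False using nonzero unfolding family_def by blast
qed

text \<open>The vector \<open>corner *v v\<close> generates the module, and between two corners every family member
  collapses to zero or to a power of the corner.\<close>

lemma range_corner_subset_span:
  assumes "corner *v v \<noteq> 0"
  shows "corner *v u \<in> vec.span {E k a0 b0 *v (corner *v v) | k. 1 \<le> k}"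
proof -
  let ?S = "{E k a0 b0 *v (corner *v v) | k. 1 \<le> k}"
  have "u \<in> vec.span {M *v (corner *v v) | M. M \<in> family}"
    using span_orbit[OF assms] by simp
  then show ?thesis
  proof (induction rule: vec.span_induct_alt)
    case (step d y z)
    then obtain k a b where y: "1 \<le> k" "a \<in> A" "b \<in> B" "y = E k a b *v (corner *v v)"
      unfolding family_def by blast
    have "corner ** (E k a b ** corner) = 0 \<or> (\<exists>l\<ge>2. corner ** (E k a b ** corner) = E l a0 b0)"
    proof (cases "q b a0")
      case None
      then show ?thesis
        using mult[of k 1 a a0 b b0] y(1-3) base
        by (simp add: corner_def matrix_eq flip: matrix_vector_mul_assoc)
    next
      case (Some m)
      then have "corner ** (E k a b ** corner) = corner ** E (k + m + 1) a b0"
        using mult[of k 1 a a0 b b0] y(1-3) base by (simp add: corner_def)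
      then show ?thesis
        using mult[of 1 "k + m + 1" a0 a b0 b0] y(1-3) base
        by (cases "q b0 a") (auto simp: corner_def intro!: exI[of _ "1 + _ + (k + m + 1)"])
    qed
    then consider "corner *v y = 0" | l where "l \<ge> 2" "corner *v y = E l a0 b0 *v v"
      unfolding y(4) by (auto simp: matrix_vector_mul_assoc matrix_mul_assoc)
    then have "corner *v y \<in> vec.span ?S"
    proof cases
      case 1
      then show ?thesis by (simp add: vec.span_zero)
    next
      case (2 l)
      then have "corner *v y = E (l - 1) a0 b0 *v (corner *v v)"
        using E_Suc_base[of "l - 1"] by (simp add: matrix_vector_mul_assoc)
      then show ?thesis
        using 2(1) by (intro vec.span_base) (auto intro!: exI[of _ "l - 1"])
    qed
    then show ?case
      using step(2) by (simp add: vec.add vec.scale vec.span_add vec.span_scale)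
  qed (simp add: vec.span_zero)
qed

lemma E_base_eigenvector:
  assumes "corner *v w = c *s w" "1 \<le> k"
  shows "E k a0 b0 *v w = c ^ k *s w"
  using assms(2)
proof (induction rule: dec_induct)
  case base
  then show ?case using assms(1) by (simp add: corner_def)
next
  case (step k)
  then show ?case
    using assms(1) by (simp add: E_Suc_base vec.scale mult.commute flip: matrix_vector_mul_assoc)
qed

text \<open>Take \<open>w\<close> to be an eigenvector inside the range of the corner. Its span contains all its images
  under powers of the corner, hence the whole range, and the eigenvalue cannot be zero since these images
  span a nonzero space.\<close>

lemma corner_rank_one:
  obtains c w where "c \<noteq> 0" "w \<noteq> 0" "corner *v w = c *s w" "\<forall>v. \<exists>d. corner *v v = d *s w"
proof -
  have "vec.subspace (range ((*v) corner))"
    using vec.subspace_image[OF vec.subspace_UNIV] .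
  moreover obtain v where "corner *v v \<noteq> 0"
    using corner_nonzero by (auto simp: matrix_eq)
  ultimately obtain c w where w: "w \<in> range ((*v) corner)" "w \<noteq> 0" "corner *v w = c *s w"
    using exists_eigenvector[of "range ((*v) corner)" corner "corner *v v"] by blast
  have sub: "corner *v u \<in> vec.span {w}" for u
  proof -
    obtain v' where "w = corner *v v'" using w(1) by blast
    then have "corner *v u \<in> vec.span {E k a0 b0 *v w | k. 1 \<le> k}"
      using range_corner_subset_span[of v' u] w(2) by simp
    also have "vec.span {E k a0 b0 *v w | k. 1 \<le> k} \<subseteq> vec.span {w}"
      by (rule vec.span_minimal)
        (auto simp: E_base_eigenvector[OF w(3)] vec.span_base vec.span_scale)
    finally show ?thesis .
  qed
  then have ex: "\<exists>d. corner *v u = d *s w" for u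
    by (auto simp: vec.span_singleton)
  have "c \<noteq> 0"
  proof
    assume "c = 0"
    obtain v' where v': "w = corner *v v'" using w(1) by blast
    have "corner *v u = 0" for u
    proof -
      have "corner *v u \<in> vec.span {E k a0 b0 *v w | k. 1 \<le> k}"
        using range_corner_subset_span[of v' u] w(2) v' by simp
      also have "{E k a0 b0 *v w | k. 1 \<le> k} \<subseteq> {0}"
        by (auto simp: E_base_eigenvector[OF w(3)] \<open>c = 0\<close> power_0_left)
      then have "vec.span {E k a0 b0 *v w | k. 1 \<le> k} \<subseteq> vec.span {0}"
        by (rule vec.span_mono)
      finally show ?thesis by simp
    qed
    then show False using corner_nonzero by (simp add: matrix_eq)
  qed
  then show ?thesis using that w ex by blast
qed

lemma corner_square_and_idempotent:
  obtains c e where "c \<noteq> 0" "corner ** corner = mat_scale c corner" "corner = mat_scale c e" "e ** e = e" "rank e = 1"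
proof -
  obtain c w where cw: "c \<noteq> 0" "w \<noteq> 0" "corner *v w = c *s w" and ex: "\<forall>v. \<exists>d. corner *v v = d *s w"
    by (rule corner_rank_one)
  define e where "e = mat_scale (1 / c) corner"
  have square: "corner ** corner = mat_scale c corner"
  proof -
    have "(corner ** corner) *v v = mat_scale c corner *v v" for v
    proof -
      obtain d where "corner *v v = d *s w" using ex by blast
      then show ?thesis
        by (simp add: mat_scale_vector vec.scale cw(3) mult.commute flip: matrix_vector_mul_assoc)
    qed
    then show ?thesis by (simp add: matrix_eq)
  qed
  have xe: "corner = mat_scale c e"
    using cw(1) by (simp add: e_def mat_scale_scale)
  have "e ** e = e"
    using cw(1) by (simp add: e_def mat_scale_mult square mat_scale_scale)
  moreover have "rank e = 1"
  proof (rule rank_eq_1_if_range_in_line)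
    show "e \<noteq> 0" using xe corner_nonzero by (auto simp: mat_scale_def vec_eq_iff)
    show "\<exists>d. e *v v = d *s w" for v
    proof -
      obtain d where "corner *v v = d *s w" using ex by blast
      then have "e *v v = (1 / c * d) *s w"
        by (simp add: e_def mat_scale_vector)
      then show ?thesis ..
    qed
  qed
  ultimately show ?thesis using that cw(1) square xe by blast
qed

text \<open>For exponents at least three, the factorization through the corner reduces the claim to the
  equation for the square of the corner. Small exponents follow because the difference of both sides is
  annihilated by all products of two members of the family.\<close>

lemma E_shift:
  assumes c: "corner ** corner = mat_scale c corner" and k: "1 \<le> k" "a \<in> A" "b \<in> B"
  shows "E (Suc k) a b = mat_scale c (E k a b)"
proof -
  have large: "E (Suc k) a b = mat_scale c (E k a b)" if k: "3 \<le> k" "a \<in> A" "b \<in> B" for k a b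
  proof -
    have "1 + 0 + (k - 2) = Suc k - 2" using k by simp
    then have "corner ** E (k - 2) a0 b = E (Suc k - 2) a0 b"
      using mult[of 1 "k - 2" a0 a0 b0 b] base k by (simp add: corner_def)
    then have "E (Suc k) a b = E 1 a b0 ** (corner ** corner) ** E (k - 2) a0 b"
      using E_factor_through_corner[of "Suc k" a b] k by (simp flip: matrix_mul_assoc)
    then have "E (Suc k) a b *v v = mat_scale c (E k a b) *v v" for v
      by (simp add: c E_factor_through_corner[OF k] mat_scale_vector vec.scale flip: matrix_vector_mul_assoc)
    then show ?thesis by (simp add: matrix_eq)
  qed
  have "E (Suc k) a b - mat_scale c (E k a b) = 0"
  proof (rule matrix_eq_zeroI)
    have distr: "M ** (F - mat_scale c G) = M ** F - mat_scale c (M ** G)" for M F G :: "'k^'r^'r"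
      by (simp add: matrix_eq mat_scale_vector matrix_vector_mult_diff_rdistrib vec.diff vec.scale
          flip: matrix_vector_mul_assoc)
    fix M N assume "M \<in> family" "N \<in> family"
    then obtain l a' b' l' a'' b'' where N: "N = E l a' b'" "1 \<le> l" "a' \<in> A" "b' \<in> B"
      and M: "M = E l' a'' b''" "1 \<le> l'" "a'' \<in> A" "b'' \<in> B"
      unfolding family_def by blast
    have "M ** (N ** E (Suc k) a b) = mat_scale c (M ** (N ** E k a b))"
    proof (cases "q b' a")
      case None
      then show ?thesis
        using mult[OF N(2) _ N(3) k(2) N(4) k(3)] k(1)
        by (simp add: N(1) matrix_eq mat_scale_vector flip: matrix_vector_mul_assoc)
    next
      case (Some m)
      then have "N ** E (Suc k) a b = E (Suc (l + m + k)) a' b" "N ** E k a b = E (l + m + k) a' b"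
        using mult[OF N(2) _ N(3) k(2) N(4) k(3)] k(1) by (simp_all add: N(1))
      moreover have "M ** E (Suc (l + m + k)) a' b = mat_scale c (M ** E (l + m + k) a' b)"
        using mult[OF M(2) _ M(3) N(3) M(4) k(3)] k M(2,3) N(2) large
        by (cases "q b'' a'") (simp_all add: M(1) matrix_eq mat_scale_vector)
      ultimately show ?thesis by simp
    qed
    then show "M ** (N ** (E (Suc k) a b - mat_scale c (E k a b))) = 0"
      by (simp add: distr)
  qed
  then show ?thesis by simp
qed

lemma E_eq_power:
  assumes c: "corner ** corner = mat_scale c corner" and "1 \<le> k" "a \<in> A" "b \<in> B"
  shows "E k a b = mat_scale (c ^ (k - 1)) (E 1 a b)"
  using assms(2)
proof (induction rule: dec_induct)
  case (step k)
  then have "c * c ^ (k - 1) = c ^ (Suc k - 1)"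
    by (cases k) simp_all
  with step show ?case
    using E_shift[OF c _ assms(3,4)] by (simp add: mat_scale_scale)
qed simp

end


section \<open>Contracted semigroup algebras\<close>

text \<open>This is linear only on finitely supported \<open>f\<close>.\<close>

definition linear_extension :: "('t \<Rightarrow> 'k::field^'r^'r) \<Rightarrow> ('t \<Rightarrow> 'k) \<Rightarrow> 'k^'r^'r" where
  "linear_extension g f = (\<Sum>x | f x \<noteq> 0. mat_scale (f x) (g x))"

lemma linear_extension_superset:
  assumes "finite S" "{x. f x \<noteq> 0} \<subseteq> S"
  shows "linear_extension g f = (\<Sum>x\<in>S. mat_scale (f x) (g x))"
  unfolding linear_extension_def
  by (rule sum.mono_neutral_left) (use assms in auto)

lemma linear_extension_cong:
  assumes "\<And>x. f x \<noteq> 0 \<Longrightarrow> g x = g' x"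
  shows "linear_extension g f = linear_extension g' f"
  unfolding linear_extension_def using assms by (intro sum.cong) auto

lemma calg_map_apply:
  assumes "inj_on h {x. f x \<noteq> 0}" "f x \<noteq> 0"
  shows "calg_map h f (h x) = f x"
proof -
  have "{x'. f x' \<noteq> 0 \<and> h x' = h x} = {x}"
    using assms by (auto dest: inj_onD)
  then show ?thesis by (simp add: calg_map_def)
qed

lemma calg_map_support:
  assumes "inj_on h {x. f x \<noteq> 0}"
  shows "{y. calg_map h f y \<noteq> 0} = h ` {x. f x \<noteq> 0}"
proof -
  have "calg_map h f y = 0" if "y \<notin> h ` {x. f x \<noteq> 0}" for y
  proof -
    have "{x. f x \<noteq> 0 \<and> h x = y} = {}" using that by auto
    then show ?thesis unfolding calg_map_def by (simp only: sum.empty)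
  qed
  then show ?thesis using calg_map_apply[OF assms] by fastforce
qed

lemma linear_extension_calg_map:
  assumes "inj_on h {x. f x \<noteq> 0}"
  shows "linear_extension g (calg_map h f) = linear_extension (\<lambda>x. g (h x)) f"
  unfolding linear_extension_def calg_map_support[OF assms] sum.reindex[OF assms]
  by (rule sum.cong) (auto simp: calg_map_apply[OF assms])

text \<open>An absorbing zero is what makes representations of the contracted algebra the same as
  multiplicative maps on the basis that vanish at \<open>\<theta>\<close>.\<close>

locale magma_with_zero =
  fixes T :: "'t semigroup0"
  assumes zero_closed: "szero T \<in> carrier T"
    and smult_closed: "x \<in> carrier T \<Longrightarrow> y \<in> carrier T \<Longrightarrow> smult T x y \<in> carrier T"
    and zero_left: "x \<in> carrier T \<Longrightarrow> smult T (szero T) x = szero T"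
    and zero_right: "x \<in> carrier T \<Longrightarrow> smult T x (szero T) = szero T"
begin

lemma calg_add: "f \<in> calg T \<Longrightarrow> g \<in> calg T \<Longrightarrow> (\<lambda>x. f x + g x) \<in> calg T"
proof -
  assume fg: "f \<in> calg T" "g \<in> calg T"
  have "{x. f x + g x \<noteq> 0} \<subseteq> {x. f x \<noteq> 0} \<union> {x. g x \<noteq> 0}" by auto
  with fg show ?thesis
    unfolding calg_def by (blast intro: finite_subset)
qed

lemma calg_scale: "f \<in> calg T \<Longrightarrow> (\<lambda>x. c * f x) \<in> calg T"
  by (cases "c = 0") (simp_all add: calg_def)

lemma calg_elt_closed: "x \<in> carrier T \<Longrightarrow> calg_elt T x \<in> calg T"
  by (auto simp: calg_def calg_elt_def)

lemma calg_mult_support: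
  "{z. calg_mult T f g z \<noteq> 0} \<subseteq> (\<lambda>(x, y). smult T x y) ` ({x. f x \<noteq> 0} \<times> {y. g y \<noteq> 0}) - {szero T}"
proof
  fix z assume "z \<in> {z. calg_mult T f g z \<noteq> 0}"
  then have z: "z \<noteq> szero T"
    "(\<Sum>(x, y) \<in> {(x, y). f x \<noteq> 0 \<and> g y \<noteq> 0 \<and> smult T x y = z}. f x * g y) \<noteq> 0"
    by (auto simp: calg_mult_def split: if_splits)
  then have "{(x, y). f x \<noteq> 0 \<and> g y \<noteq> 0 \<and> smult T x y = z} \<noteq> {}"
    by (metis (no_types, lifting) sum.empty)
  then show "z \<in> (\<lambda>(x, y). smult T x y) ` ({x. f x \<noteq> 0} \<times> {y. g y \<noteq> 0}) - {szero T}"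
    using z(1) by auto
qed

lemma calg_mult_closed:
  assumes "f \<in> calg T" "g \<in> calg T"
  shows "calg_mult T f g \<in> calg T"
proof -
  have fin: "finite {x. f x \<noteq> 0}" "finite {y. g y \<noteq> 0}"
    and sub: "{x. f x \<noteq> 0} \<subseteq> carrier T" "{y. g y \<noteq> 0} \<subseteq> carrier T"
    using assms by (auto simp: calg_def)
  have "(\<lambda>(x, y). smult T x y) ` ({x. f x \<noteq> 0} \<times> {y. g y \<noteq> 0}) \<subseteq> carrier T"
    using sub smult_closed by auto
  then show ?thesis
    unfolding calg_def using calg_mult_support[of f g] fin
    by (auto intro: finite_subset)
qed

lemma calg_elt_mult:
  assumes "x \<in> carrier T" "y \<in> carrier T"
  shows "calg_mult T (calg_elt T x) (calg_elt T y) = (calg_elt T (smult T x y) :: 't \<Rightarrow> 'k::field)"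
proof (rule ext)
  fix z
  show "calg_mult T (calg_elt T x) (calg_elt T y) z = (calg_elt T (smult T x y) z :: 'k)"
  proof (cases "x \<noteq> szero T \<and> y \<noteq> szero T \<and> smult T x y = z")
    case True
    then have "{(x', y'). (calg_elt T x x' :: 'k) \<noteq> 0 \<and> (calg_elt T y y' :: 'k) \<noteq> 0 \<and> smult T x' y' = z}
        = {(x, y)}"
      by (auto simp: calg_elt_def split: if_splits)
    then show ?thesis using True by (simp add: calg_mult_def) (simp add: calg_elt_def)
  next
    case False
    then have empty: "{(x', y'). (calg_elt T x x' :: 'k) \<noteq> 0 \<and> (calg_elt T y y' :: 'k) \<noteq> 0
        \<and> smult T x' y' = z} = {}"
      by (auto simp: calg_elt_def split: if_splits)
    have "calg_mult T (calg_elt T x) (calg_elt T y) z = (0 :: 'k)"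
      unfolding calg_mult_def empty by simp
    moreover have "calg_elt T (smult T x y) z = (0 :: 'k)"
      using False assms zero_left zero_right by (auto simp: calg_elt_def)
    ultimately show ?thesis by simp
  qed
qed

text \<open>In the product of two combinations, the pairs \<open>(x, y)\<close> are grouped according to \<open>z = x y\<close>; the
  group with \<open>z = \<theta>\<close> is missing from the algebra but contributes nothing because \<open>g\<close> vanishes there.\<close>

lemma representation_linear_extension:
  fixes g :: "'t \<Rightarrow> 'k::field^'r^'r"
  assumes g0: "g (szero T) = 0"
    and gm: "\<And>x y. x \<in> carrier T \<Longrightarrow> y \<in> carrier T \<Longrightarrow> g (smult T x y) = g x ** g y"
  shows "representation T (linear_extension g)"
  unfolding representation_def
proof (intro conjI ballI allI)
  fix f h :: "'t \<Rightarrow> 'k" assume fh: "f \<in> calg T" "h \<in> calg T"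
  let ?F = "{x. f x \<noteq> 0}" and ?H = "{x. h x \<noteq> 0}"
  have fin: "finite ?F" "finite ?H" and sub: "?F \<subseteq> carrier T" "?H \<subseteq> carrier T"
    using fh by (auto simp: calg_def)
  show "linear_extension g (\<lambda>x. f x + h x) = linear_extension g f + linear_extension g h"
  proof -
    have "{x. f x + h x \<noteq> 0} \<subseteq> ?F \<union> ?H" by auto
    then show ?thesis
      using fin by (simp add: linear_extension_superset[of "?F \<union> ?H"] mat_scale_add sum.distrib)
  qed
  show "linear_extension g (calg_mult T f h) = linear_extension g f ** linear_extension g h"
  proof -
    let ?m = "\<lambda>(x, y). smult T x y"
    let ?Z = "?m ` (?F \<times> ?H)"
    let ?t = "\<lambda>(x, y). mat_scale (f x) (g x) ** mat_scale (h y) (g y)"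
    have finZ: "finite ?Z" using fin by simp
    have "linear_extension g (calg_mult T f h) = (\<Sum>z\<in>?Z. mat_scale (calg_mult T f h z) (g z))"
      using calg_mult_support[of f h] by (intro linear_extension_superset finZ) blast
    also have "\<dots> = (\<Sum>z\<in>?Z. \<Sum>p\<in>{p \<in> ?F \<times> ?H. ?m p = z}. ?t p)"
    proof (rule sum.cong[OF HOL.refl])
      fix z
      have t: "?t p = mat_scale (f (fst p) * h (snd p)) (g z)" if "p \<in> {p \<in> ?F \<times> ?H. ?m p = z}" for p
      proof -
        have "fst p \<in> carrier T" "snd p \<in> carrier T" "z = smult T (fst p) (snd p)"
          using that sub by auto
        then show ?thesis by (simp add: gm mat_scale_mult case_prod_beta)
      qed
      have set: "{(x, y). f x \<noteq> 0 \<and> h y \<noteq> 0 \<and> smult T x y = z} = {p \<in> ?F \<times> ?H. ?m p = z}"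
        by auto
      have "(\<Sum>p\<in>{p \<in> ?F \<times> ?H. ?m p = z}. ?t p)
          = mat_scale (\<Sum>p\<in>{p \<in> ?F \<times> ?H. ?m p = z}. f (fst p) * h (snd p)) (g z)"
        unfolding mat_scale_sum using t by (rule sum.cong[OF HOL.refl])
      then show "mat_scale (calg_mult T f h z) (g z) = (\<Sum>p\<in>{p \<in> ?F \<times> ?H. ?m p = z}. ?t p)"
        unfolding calg_mult_def set using g0 by (simp add: case_prod_beta)
    qed
    also have "\<dots> = (\<Sum>p\<in>?F \<times> ?H. ?t p)"
      by (rule sum.group) (use fin finZ in auto)
    also have "\<dots> = linear_extension g f ** linear_extension g h"
      unfolding linear_extension_def matrix_sum_mult_sum ..
    finally show ?thesis .
  qed
next
  fix c and f :: "'t \<Rightarrow> 'k" assume f: "f \<in> calg T"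
  then have "finite {x. f x \<noteq> 0}" by (simp add: calg_def)
  then have "linear_extension g (\<lambda>x. c * f x) = (\<Sum>x | f x \<noteq> 0. mat_scale (c * f x) (g x))"
    by (rule linear_extension_superset) auto
  then show "linear_extension g (\<lambda>x. c * f x) = mat_scale c (linear_extension g f)"
    by (simp add: linear_extension_def mat_scale_sum_right mat_scale_scale)
qed

lemma representation_eq_linear_extension:
  fixes \<phi> :: "('t \<Rightarrow> 'k::field) \<Rightarrow> 'k^'r^'r"
  assumes \<phi>: "representation T \<phi>" and f: "f \<in> calg T"
  shows "\<phi> f = linear_extension (\<lambda>x. \<phi> (calg_elt T x)) f"
proof -
  have add: "\<And>f h. f \<in> calg T \<Longrightarrow> h \<in> calg T \<Longrightarrow> \<phi> (\<lambda>x. f x + h x) = \<phi> f + \<phi> h"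
    and scale: "\<And>c f. f \<in> calg T \<Longrightarrow> \<phi> (\<lambda>x. c * f x) = mat_scale c (\<phi> f)"
    using \<phi> unfolding representation_def by blast+
  have "(\<lambda>y. \<Sum>x\<in>S. f x * calg_elt T x y) \<in> calg T \<and>
      \<phi> (\<lambda>y. \<Sum>x\<in>S. f x * calg_elt T x y) = (\<Sum>x\<in>S. mat_scale (f x) (\<phi> (calg_elt T x)))"
    if "finite S" "S \<subseteq> carrier T" for S
    using that
  proof (induction S)
    case empty
    then show ?case using scale[OF f, of 0] by (simp add: calg_def)
  next
    case (insert x S)
    then have "calg_elt T x \<in> (calg T :: ('t \<Rightarrow> 'k) set)" by (simp add: calg_elt_closed)
    with insert show ?case
      by (simp add: add scale calg_scale calg_add)
  qed
  moreover have fin: "finite {x. f x \<noteq> 0}" and sub: "{x. f x \<noteq> 0} \<subseteq> carrier T - {szero T}"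
    using f by (auto simp: calg_def)
  ultimately have "\<phi> (\<lambda>y. \<Sum>x | f x \<noteq> 0. f x * calg_elt T x y) = linear_extension (\<lambda>x. \<phi> (calg_elt T x)) f"
    unfolding linear_extension_def by blast
  moreover have "(\<lambda>y. \<Sum>x | f x \<noteq> 0. f x * calg_elt T x y) = f"
  proof (rule ext)
    fix y
    have "(\<Sum>x | f x \<noteq> 0. f x * calg_elt T x y) = (\<Sum>x | f x \<noteq> 0. if x = y then f x else 0)"
      using sub by (intro sum.cong) (auto simp: calg_elt_def)
    then show "(\<Sum>x | f x \<noteq> 0. f x * calg_elt T x y) = f y"
      using fin by simp
  qed
  ultimately show ?thesis by simp
qed

lemma representation_mult_elt:
  assumes "representation T \<phi>" "x \<in> carrier T" "y \<in> carrier T"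
  shows "\<phi> (calg_elt T x) ** \<phi> (calg_elt T y) = \<phi> (calg_elt T (smult T x y))"
  using assms calg_elt_closed calg_elt_mult unfolding representation_def by metis

lemma representation_zero_elt:
  fixes \<phi> :: "('t \<Rightarrow> 'k::field) \<Rightarrow> 'k^'r^'r"
  assumes "representation T \<phi>"
  shows "\<phi> (calg_elt T (szero T)) = 0"
proof -
  have "calg_elt T (szero T) \<in> calg T" by (rule calg_elt_closed[OF zero_closed])
  then have "\<phi> (\<lambda>x. 0 * calg_elt T (szero T) x) = mat_scale 0 (\<phi> (calg_elt T (szero T)))"
    using assms unfolding representation_def by blast
  moreover have "(\<lambda>x. 0 * calg_elt T (szero T) x) = (calg_elt T (szero T) :: 't \<Rightarrow> 'k)"
    by (auto simp: calg_elt_def)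
  ultimately show ?thesis by simp
qed

lemma representation_cong:
  assumes "representation T \<phi>" "\<And>f. f \<in> calg T \<Longrightarrow> \<psi> f = \<phi> f"
  shows "representation T \<psi>"
  using assms unfolding representation_def
  by (simp add: calg_add calg_scale calg_mult_closed)

lemma irreducible_representation_elt:
  assumes \<phi>: "irreducible_representation T \<phi>"
  shows "\<exists>x\<in>carrier T. \<phi> (calg_elt T x) \<noteq> 0"
    and "\<lbrakk>vec.subspace W; \<And>x w. x \<in> carrier T \<Longrightarrow> w \<in> W \<Longrightarrow> \<phi> (calg_elt T x) *v w \<in> W\<rbrakk>
      \<Longrightarrow> W = {0} \<or> W = UNIV"
proof -
  have rep: "\<phi> f = linear_extension (\<lambda>x. \<phi> (calg_elt T x)) f" if "f \<in> calg T" for f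
    using \<phi> that unfolding irreducible_representation_def
    by (intro representation_eq_linear_extension) auto
  obtain f where f: "f \<in> calg T" "\<phi> f \<noteq> 0"
    using \<phi> unfolding irreducible_representation_def by blast
  show "\<exists>x\<in>carrier T. \<phi> (calg_elt T x) \<noteq> 0"
  proof (rule ccontr)
    assume "\<not> ?thesis"
    moreover have "{x. f x \<noteq> 0} \<subseteq> carrier T" using f(1) by (auto simp: calg_def)
    ultimately have "linear_extension (\<lambda>x. \<phi> (calg_elt T x)) f = 0"
      unfolding linear_extension_def by (intro sum.neutral) auto
    then show False using f rep by simp
  qed
  assume W: "vec.subspace W" "\<And>x w. x \<in> carrier T \<Longrightarrow> w \<in> W \<Longrightarrow> \<phi> (calg_elt T x) *v w \<in> W"
  have "\<phi> f *v w \<in> W" if fw: "f \<in> calg T" "w \<in> W" for f w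
  proof -
    have "(\<Sum>x\<in>S. mat_scale (f x) (\<phi> (calg_elt T x))) *v w \<in> W" if "S \<subseteq> carrier T" for S
      using that
      by (induction S rule: infinite_finite_induct)
        (auto simp: vec.subspace_0[OF W(1)] matrix_vector_mult_add_rdistrib mat_scale_vector
          intro!: vec.subspace_add[OF W(1)] vec.subspace_scale[OF W(1)] W(2) fw(2))
    moreover have "{x. f x \<noteq> 0} \<subseteq> carrier T" using fw(1) by (auto simp: calg_def)
    ultimately show ?thesis
      unfolding rep[OF fw(1)] linear_extension_def by blast
  qed
  then show "W = {0} \<or> W = UNIV"
    using \<phi> W(1) unfolding irreducible_representation_def by blast
qed

end

text \<open>A subspace invariant under a larger image is invariant under the smaller one.\<close>

lemma irreducible_representation_of_image:
  fixes \<phi> :: "('t \<Rightarrow> 'k::field) \<Rightarrow> 'k^'r^'r" and \<psi> :: "('u \<Rightarrow> 'k) \<Rightarrow> 'k^'r^'r"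
  assumes "irreducible_representation T \<phi>" "representation U \<psi>"
    and "\<And>f. f \<in> calg T \<Longrightarrow> \<exists>f'\<in>calg U. \<psi> f' = \<phi> f"
  shows "irreducible_representation U \<psi>"
  using assms unfolding irreducible_representation_def by metis

lemma calg_map_closed:
  assumes "inj_on h (carrier T)" "h ` carrier T \<subseteq> carrier U" "h (szero T) = szero U"
    "szero T \<in> carrier T" "f \<in> calg T"
  shows "calg_map h f \<in> calg U"
proof -
  have sub: "{x. f x \<noteq> 0} \<subseteq> carrier T - {szero T}" and fin: "finite {x. f x \<noteq> 0}"
    using assms(5) by (auto simp: calg_def)
  then have "inj_on h {x. f x \<noteq> 0}"
    using assms(1) by (auto intro: inj_on_subset)
  moreover have "h x \<noteq> szero U" if "f x \<noteq> 0" for x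
  proof
    assume "h x = szero U"
    moreover have x: "x \<in> carrier T" "x \<noteq> szero T" using that sub by auto
    ultimately show False using inj_onD[OF assms(1), of x "szero T"] assms(3,4) by simp
  qed
  ultimately show ?thesis
    using sub fin assms(2) by (auto simp: calg_def calg_map_support)
qed

lemma calg_map_elt:
  assumes "x \<noteq> szero T" "h x \<noteq> szero U"
  shows "calg_map h (calg_elt T x) = (calg_elt U (h x) :: 'u \<Rightarrow> 'k::field)"
proof (rule ext)
  fix y
  have "{x'. (calg_elt T x x' :: 'k) \<noteq> 0 \<and> h x' = y} = (if h x = y then {x} else {})"
    using assms by (auto simp: calg_elt_def)
  then have "calg_map h (calg_elt T x) y = (\<Sum>x'\<in>(if h x = y then {x} else {}). calg_elt T x x' :: 'k)"
    unfolding calg_map_def by (simp only:)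
  then show "calg_map h (calg_elt T x) y = (calg_elt U (h x) y :: 'k)"
    using assms by (cases "h x = y") (simp_all add: calg_elt_def)
qed


section \<open>Matrix coordinates for \<open>M\<^sub>i\<close> and the extension to \<open>gr(s\<^sub>i)\<close>\<close>

locale hk_matrix_form =
  fixes n i :: nat and A B :: "nat list set set" and P :: hk_matrix
  assumes n: "n \<ge> 3" and i: "i \<le> n - 2" and form: "matrix_form n i A B P"
begin

abbreviation T :: "(nat list set \<times> nat list set \<times> nat list set) option semigroup0" where
  "T \<equiv> M_matrix n i A B P"

abbreviation U :: "(int \<times> nat list set \<times> nat list set) option semigroup0" where
  "U \<equiv> M_gr n i A B P"

abbreviation one_hk :: "nat list set" where
  "one_hk \<equiv> \<one>\<^bsub>hk n\<^esub>"

text \<open>The matrix \<open>P\<close> with each entry \<open>s\<^sub>i\<^sup>m\<close> replaced by \<open>m\<close>; it serves both the semigroup over \<open>S\<^sub>i\<close> and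
  the one over \<open>gr(s\<^sub>i)\<close>.\<close>

definition entry_exponent :: "nat list set \<Rightarrow> nat list set \<Rightarrow> nat option" where
  "entry_exponent b a = map_option (\<lambda>p. nat (s_exponent n i p)) (P b a)"

definition triple :: "nat \<Rightarrow> nat list set \<Rightarrow> nat list set
    \<Rightarrow> (nat list set \<times> nat list set \<times> nat list set) option" where
  "triple k a b = Some (s_elt n i [^]\<^bsub>hk n\<^esub> k, a, b)"

lemma one_in: "one_hk \<in> A" "one_hk \<in> B"
  using form unfolding matrix_form_def by blast+

lemma P_eq:
  assumes "b \<in> B" "a \<in> A"
  shows "P b a = map_option (\<lambda>m. s_elt n i [^]\<^bsub>hk n\<^esub> m) (entry_exponent b a)"
  by (rule matrix_form_entry[OF form assms]) (simp_all add: entry_exponent_def s_exponent_pow[OF n i])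

lemma P_exponent_eq:
  assumes "b \<in> B" "a \<in> A"
  shows "map_option (s_exponent n i) (P b a) = map_option int (entry_exponent b a)"
  by (cases "entry_exponent b a") (simp_all add: P_eq[OF assms] s_exponent_pow[OF n i])

lemma entry_exponent_one: "entry_exponent one_hk one_hk = Some 0"
  using matrix_form_entry_one[OF n i form] s_exponent_pow[OF n i, of 0] by (simp add: entry_exponent_def)

lemma carrier_T: "carrier T = insert None {triple k a b | k a b. 1 \<le> k \<and> a \<in> A \<and> b \<in> B}"
  unfolding M_matrix_def matrix_semigroup_def s_semigroup_def triple_def by auto

lemma carrier_U: "carrier U = insert None (Some ` (UNIV \<times> A \<times> B))"
  unfolding M_gr_def matrix_semigroup_def by auto

lemma szero_T: "szero T = None" and szero_U: "szero U = None"
  by (simp_all add: M_matrix_def M_gr_def matrix_semigroup_def)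

lemma triple_in: "1 \<le> k \<Longrightarrow> a \<in> A \<Longrightarrow> b \<in> B \<Longrightarrow> triple k a b \<in> carrier T"
  unfolding carrier_T by blast

lemma gr_in: "a \<in> A \<Longrightarrow> b \<in> B \<Longrightarrow> Some (z, a, b) \<in> carrier U"
  unfolding carrier_U by blast

lemma smult_T:
  assumes "b \<in> B" "a' \<in> A"
  shows "smult T (triple k a b) (triple l a' b')
    = (case entry_exponent b a' of None \<Rightarrow> None | Some m \<Rightarrow> triple (k + m + l) a b')"
proof -
  interpret Group.monoid "hk n" by (rule monoid_hk)
  show ?thesis
    using s_elt_carrier[OF n i]
    by (cases "entry_exponent b a'")
      (simp_all add: P_eq[OF assms] M_matrix_def matrix_semigroup_def triple_def nat_pow_mult)
qed

lemma smult_U: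
  assumes "b \<in> B" "a' \<in> A"
  shows "smult U (Some (z, a, b)) (Some (y, a', b'))
    = (case entry_exponent b a' of None \<Rightarrow> None | Some m \<Rightarrow> Some (z + int m + y, a, b'))"
proof -
  have "smult U (Some (z, a, b)) (Some (y, a', b'))
      = (case map_option (s_exponent n i) (P b a') of None \<Rightarrow> None | Some p \<Rightarrow> Some (z + p + y, a, b'))"
    by (simp add: M_gr_def matrix_semigroup_def split: option.split)
  then show ?thesis
    unfolding P_exponent_eq[OF assms] by (simp split: option.split)
qed

lemma smult_None: "smult T x None = None" "smult T None x = None"
  "smult U y None = None" "smult U None y = None"
  by (auto simp: M_matrix_def M_gr_def matrix_semigroup_def split: option.split)

lemma magma_T: "magma_with_zero T"
proof
  fix x y assume xy: "x \<in> carrier T" "y \<in> carrier T"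
  have None: "None \<in> carrier T" by (simp add: carrier_T)
  show "smult T x y \<in> carrier T"
  proof (cases "x = None \<or> y = None")
    case True
    then show ?thesis using None by (auto simp: smult_None)
  next
    case False
    then obtain k a b l a' b' where "x = triple k a b" "y = triple l a' b'" "1 \<le> k"
      "a \<in> A" "b \<in> B" "a' \<in> A" "b' \<in> B"
      using xy unfolding carrier_T by blast
    then show ?thesis
      using None by (simp add: smult_T triple_in split: option.split)
  qed
qed (simp_all add: szero_T smult_None carrier_T)

lemma magma_U: "magma_with_zero U"
proof
  fix x y assume xy: "x \<in> carrier U" "y \<in> carrier U"
  have None: "None \<in> carrier U" by (simp add: carrier_U)
  show "smult U x y \<in> carrier U"
  proof (cases "x = None \<or> y = None")
    case True
    then show ?thesis using None by (auto simp: smult_None)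
  next
    case False
    then obtain z a b z' a' b' where "x = Some (z, a, b)" "y = Some (z', a', b')"
      "a \<in> A" "b \<in> B" "a' \<in> A" "b' \<in> B"
      using xy unfolding carrier_U by auto
    then show ?thesis
      using None by (simp add: smult_U gr_in split: option.split)
  qed
qed (simp_all add: szero_U smult_None carrier_U)

lemma M_incl_triple: "M_incl n i (triple k a b) = Some (int k, a, b)"
  by (simp add: M_incl_def triple_def s_exponent_pow[OF n i])

lemma M_incl_None: "M_incl n i None = None"
  by (simp add: M_incl_def)

lemma M_incl_inj: "inj_on (M_incl n i) (carrier T)"
  by (rule inj_onI) (auto simp: carrier_T M_incl_triple M_incl_None)

lemma M_incl_carrier: "M_incl n i ` carrier T \<subseteq> carrier U"
  by (auto simp: carrier_T M_incl_triple M_incl_None gr_in) (simp add: carrier_U)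

lemma M_incl_support_inj: "f \<in> calg T \<Longrightarrow> inj_on (M_incl n i) {x. f x \<noteq> 0}"
  by (rule inj_on_subset[OF M_incl_inj]) (auto simp: calg_def)

lemma M_incl_calg: "f \<in> calg T \<Longrightarrow> calg_map (M_incl n i) f \<in> calg U"
  using M_incl_inj M_incl_carrier
  by (rule calg_map_closed) (simp_all add: szero_T szero_U M_incl_None carrier_T)

lemma M_incl_elt:
  "calg_map (M_incl n i) (calg_elt T (triple k a b)) = (calg_elt U (Some (int k, a, b)) :: _ \<Rightarrow> 'k::field)"
  using calg_map_elt[of "triple k a b" T "M_incl n i" U]
  by (simp add: szero_T szero_U M_incl_triple) (simp add: triple_def)

lemma irreducible_family:
  fixes \<phi> :: "_ \<Rightarrow> 'k::alg_closed_field^'r::finite^'r"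
  assumes \<phi>: "irreducible_representation T \<phi>"
  shows "irreducible_matrix_family (\<lambda>k a b. \<phi> (calg_elt T (triple k a b))) A B entry_exponent one_hk one_hk"
proof
  interpret magma_with_zero T by (rule magma_T)
  have rep: "representation T \<phi>"
    using \<phi> by (simp add: irreducible_representation_def)
  have z: "\<phi> (calg_elt T None) = 0"
    using representation_zero_elt[OF rep] by (simp add: szero_T)
  show "one_hk \<in> A" "one_hk \<in> B" "entry_exponent one_hk one_hk = Some 0"
    by (rule one_in entry_exponent_one)+
  show "\<phi> (calg_elt T (triple k a b)) ** \<phi> (calg_elt T (triple l a' b'))
      = (case entry_exponent b a' of None \<Rightarrow> 0 | Some m \<Rightarrow> \<phi> (calg_elt T (triple (k + m + l) a b')))"
    if "1 \<le> k" "1 \<le> l" "a \<in> A" "a' \<in> A" "b \<in> B" "b' \<in> B" for k l a a' b b'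
    using representation_mult_elt[OF rep triple_in triple_in, of k a b l a' b'] that
    by (simp add: smult_T z split: option.split)
  show "\<exists>k a b. 1 \<le> k \<and> a \<in> A \<and> b \<in> B \<and> \<phi> (calg_elt T (triple k a b)) \<noteq> 0"
    using irreducible_representation_elt(1)[OF \<phi>] z unfolding carrier_T by blast
  show "W = {0} \<or> W = UNIV"
    if "vec.subspace W"
      "\<And>k a b w. \<lbrakk>1 \<le> k; a \<in> A; b \<in> B; w \<in> W\<rbrakk> \<Longrightarrow> \<phi> (calg_elt T (triple k a b)) *v w \<in> W" for W
  proof (rule irreducible_representation_elt(2)[OF \<phi> that(1)])
    fix x w assume "x \<in> carrier T" "w \<in> W"
    then show "\<phi> (calg_elt T x) *v w \<in> W"
      unfolding carrier_T using that z vec.subspace_0[OF that(1)] by auto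
  qed
qed

text \<open>The only possible values of an extension, where \<open>F a b\<close> is the value at \<open>(s\<^sub>i;a,b)\<close>; the exponent
  \<open>z - 1\<close> makes this the case \<open>z = 1\<close>.\<close>

definition extended_values :: "'k \<Rightarrow> (nat list set \<Rightarrow> nat list set \<Rightarrow> 'k::field^'r::finite^'r)
    \<Rightarrow> (int \<times> nat list set \<times> nat list set) option \<Rightarrow> 'k^'r^'r" where
  "extended_values c F x = (case x of None \<Rightarrow> 0 | Some (z, a, b) \<Rightarrow> mat_scale (c powi (z - 1)) (F a b))"

text \<open>With an entry \<open>s\<^sub>i\<^sup>m\<close>, the scalars \<open>c\<^sup>z\<^sup>-\<^sup>1\<close> and \<open>c\<^sup>z\<^sup>'\<^sup>-\<^sup>1\<close> fall short of \<open>c\<^sup>z\<^sup>+\<^sup>m\<^sup>+\<^sup>z\<^sup>'\<^sup>-\<^sup>1\<close> by exactly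
  the factor \<open>c\<^sup>m\<^sup>+\<^sup>1\<close> that \<open>F a b ** F a' b'\<close> provides.\<close>

lemma extended_values_mult:
  fixes c :: "'k::field"
  assumes c: "c \<noteq> 0"
    and F: "\<And>a b a' b'. \<lbrakk>a \<in> A; b \<in> B; a' \<in> A; b' \<in> B\<rbrakk> \<Longrightarrow>
      F a b ** F a' b' = (case entry_exponent b a' of None \<Rightarrow> 0 | Some m \<Rightarrow> mat_scale (c ^ (m + 1)) (F a b'))"
    and "x \<in> carrier U" "y \<in> carrier U"
  shows "extended_values c F (smult U x y) = extended_values c F x ** extended_values c F y"
proof (cases "x = None \<or> y = None")
  case True
  then show ?thesis by (auto simp: smult_None extended_values_def)
next
  case False
  then obtain z a b z' a' b' where xy: "x = Some (z, a, b)" "y = Some (z', a', b')"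
    and ab: "a \<in> A" "b \<in> B" "a' \<in> A" "b' \<in> B"
    using assms(3,4) unfolding carrier_U by auto
  have "c powi (z - 1) * c powi (z' - 1) * c ^ (m + 1) = c powi (z + int m + z' - 1)" for m
  proof -
    have "c powi (z - 1 + (z' - 1) + int (m + 1)) = c powi (z - 1) * c powi (z' - 1) * c powi int (m + 1)"
      by (simp only: power_int_add[OF disjI1[OF c]])
    moreover have "z - 1 + (z' - 1) + int (m + 1) = z + int m + z' - 1"
      by simp
    ultimately show ?thesis
      by (simp only: power_int_of_nat)
  qed
  then show ?thesis
    using ab by (simp add: xy smult_U F extended_values_def mat_scale_mult mat_scale_scale
        split: option.split)
qed

text \<open>Exponents may be negative, so \<open>(s\<^sub>i\<^sup>z;a,b)\<close> is \<open>(s\<^sub>i\<^sup>z\<^sup>-\<^sup>2;a,1) x (s\<^sub>i;1,b)\<close> for every integer \<open>z\<close>, and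
  putting \<open>x\<^sup>2\<close> in place of \<open>x\<close> raises the exponent by one.\<close>

lemma representation_gr_elt:
  fixes \<psi> :: "_ \<Rightarrow> 'k::field^'r::finite^'r"
  assumes \<psi>: "representation U \<psi>"
    and c: "c \<noteq> 0"
    and x: "x = \<psi> (calg_elt U (Some (1, one_hk, one_hk)))" "x ** x = mat_scale c x"
    and ab: "a \<in> A" "b \<in> B"
  shows "\<psi> (calg_elt U (Some (z, a, b))) = mat_scale (c powi (z - 1)) (\<psi> (calg_elt U (Some (1, a, b))))"
proof -
  interpret magma_with_zero U by (rule magma_U)
  define D where "D z a b = \<psi> (calg_elt U (Some (z, a, b)))" for z a b
  have mult: "D z a one_hk ** D y one_hk b = D (z + y) a b"
    if "a \<in> A" "b \<in> B" for z y a b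
    using representation_mult_elt[OF \<psi> gr_in gr_in, of a one_hk one_hk b z y] that one_in
    by (simp add: D_def smult_U entry_exponent_one)
  have x': "D 1 one_hk one_hk = x" by (simp add: D_def x(1))
  have step: "D (z + 1) a b = mat_scale c (D z a b)" for z
  proof -
    have "D z a b = D (z - 2) a one_hk ** x ** D 1 one_hk b"
      using mult[of a one_hk "z - 2" 1] mult[of a b "z - 1" 1] ab one_in by (simp flip: x')
    moreover have "D (z + 1) a b = D (z - 2) a one_hk ** (x ** x) ** D 1 one_hk b"
      using mult[of a one_hk "z - 2" 1] mult[of a one_hk "z - 1" 1] mult[of a b "z" 1] ab one_in
      by (simp add: matrix_mul_assoc flip: x')
    ultimately show ?thesis
      by (simp add: x(2) matrix_eq mat_scale_vector vec.scale flip: matrix_vector_mul_assoc)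
  qed
  have "D z a b = mat_scale (c powi (z - 1)) (D 1 a b)"
  proof (induction z rule: int_induct[where k = 1])
    case base
    show ?case by simp
  next
    case (step1 z)
    have "c * c powi (z - 1) = c powi z"
      using power_int_add[of c "z - 1" 1] c by (simp add: mult.commute)
    then show ?case
      using step[of z] step1 by (simp add: mat_scale_scale)
  next
    case (step2 z)
    have "D (z - 1) a b = mat_scale (1 / c) (D z a b)"
      using step[of "z - 1"] c by (simp add: mat_scale_scale)
    moreover have "1 / c * c powi (z - 1) = c powi (z - 1 - 1)"
      using power_int_add[of c "z - 1" "-1"] c by (simp add: power_int_minus field_simps)
    ultimately show ?case
      using step2 by (simp add: mat_scale_scale)
  qed
  then show ?thesis by (simp add: D_def)
qed

end

theorem proposition5p2:
  fixes n i :: nat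
    and A B :: "nat list set set"
    and P :: "nat list set \<Rightarrow> nat list set \<Rightarrow> nat list set option"
    and \<phi> :: "((nat list set \<times> nat list set \<times> nat list set) option \<Rightarrow> 'k::alg_closed_field)
                 \<Rightarrow> 'k^'r::finite^'r"
  assumes "n \<ge> 3" and "i \<le> n - 2"
    and "matrix_form n i A B P"
    and "irreducible_representation (M_matrix n i A B P) \<phi>"
  shows "(\<exists>(c::'k) (e::'k^'r^'r). c \<noteq> 0 \<and> e ** e = e \<and> rank e = 1 \<and>
            \<phi> (calg_elt (M_matrix n i A B P) (Some (s_elt n i, \<one>\<^bsub>hk n\<^esub>, \<one>\<^bsub>hk n\<^esub>))) = mat_scale c e)
       \<and> (\<exists>!\<psi> :: ((int \<times> nat list set \<times> nat list set) option \<Rightarrow> 'k) \<Rightarrow> 'k^'r^'r.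
            \<psi> \<in> extensional (calg (M_gr n i A B P)) \<and>
            irreducible_representation (M_gr n i A B P) \<psi> \<and>
            (\<forall>f\<in>calg (M_matrix n i A B P). \<psi> (calg_map (M_incl n i) f) = \<phi> f))"
proof -
  interpret hk_matrix_form n i A B P
    by unfold_locales (fact assms)+
  interpret T: magma_with_zero T by (rule magma_T)
  interpret U: magma_with_zero U by (rule magma_U)
  define E where "E k a b = \<phi> (calg_elt T (triple k a b))" for k a b
  interpret E: irreducible_matrix_family E A B entry_exponent one_hk one_hk
    unfolding E_def by (rule irreducible_family) (rule assms)
  obtain c e where c: "c \<noteq> 0" and square: "E.corner ** E.corner = mat_scale c E.corner"
    and e: "E.corner = mat_scale c e" "e ** e = e" "rank e = 1"
    by (rule E.corner_square_and_idempotent)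
  have "triple 1 one_hk one_hk = Some (s_elt n i, one_hk, one_hk)"
  proof -
    interpret Group.monoid "hk n" by (rule monoid_hk)
    show ?thesis using s_elt_carrier[OF n i] by (simp add: triple_def)
  qed
  then have x: "\<phi> (calg_elt T (Some (s_elt n i, one_hk, one_hk))) = E.corner"
    by (simp add: E.corner_def E_def)
  have rep: "representation T \<phi>"
    using assms(4) by (simp add: irreducible_representation_def)
  define g where "g = extended_values c (E 1)"
  define \<psi> where "\<psi> = restrict (linear_extension g) (calg U)"
  have rep_g: "representation U (linear_extension g)"
  proof (rule U.representation_linear_extension)
    show "g (szero U) = 0" by (simp add: szero_U g_def extended_values_def)
    show "g (smult U u v) = g u ** g v" if "u \<in> carrier U" "v \<in> carrier U" for u v
      unfolding g_def using c _ that
    proof (rule extended_values_mult)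
      fix a b a' b' assume ab: "a \<in> A" "b \<in> B" "a' \<in> A" "b' \<in> B"
      have "E (2 + m) a b' = mat_scale (c ^ (m + 1)) (E 1 a b')" for m
        using E.E_eq_power[OF square, of "2 + m" a b'] ab by simp
      then show "E 1 a b ** E 1 a' b'
          = (case entry_exponent b a' of None \<Rightarrow> 0 | Some m \<Rightarrow> mat_scale (c ^ (m + 1)) (E 1 a b'))"
        using E.mult[of 1 1 a a' b b'] ab by (simp split: option.split)
    qed
  qed
  have \<psi>_eq: "\<psi> f = linear_extension g f" if "f \<in> calg U" for f
    using that by (simp add: \<psi>_def)
  have rep_\<psi>: "representation U \<psi>"
    using rep_g \<psi>_eq by (rule U.representation_cong)
  have extends: "\<psi> (calg_map (M_incl n i) f) = \<phi> f" if f: "f \<in> calg T" for f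
  proof -
    have "\<psi> (calg_map (M_incl n i) f) = linear_extension (\<lambda>x. g (M_incl n i x)) f"
      using f by (simp add: \<psi>_eq M_incl_calg linear_extension_calg_map M_incl_support_inj)
    also have "\<dots> = linear_extension (\<lambda>x. \<phi> (calg_elt T x)) f"
    proof (rule linear_extension_cong)
      fix u assume "f u \<noteq> 0"
      then have "u \<in> carrier T - {szero T}" using f by (auto simp: calg_def)
      then obtain k a b where u: "u = triple k a b" "1 \<le> k" "a \<in> A" "b \<in> B"
        by (auto simp: carrier_T szero_T)
      have "g (M_incl n i u) = mat_scale (c powi (int (k - 1))) (E 1 a b)"
        using u(2) by (simp add: u(1) M_incl_triple g_def extended_values_def of_nat_diff)
      then show "g (M_incl n i u) = \<phi> (calg_elt T u)"
        using E.E_eq_power[OF square u(2-4)] by (simp add: u(1) E_def)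
    qed
    also have "\<dots> = \<phi> f"
      using T.representation_eq_linear_extension[OF rep f] ..
    finally show ?thesis .
  qed
  show ?thesis
  proof (intro conjI)
    show "\<exists>(c::'k) (e::'k^'r^'r). c \<noteq> 0 \<and> e ** e = e \<and> rank e = 1 \<and>
        \<phi> (calg_elt T (Some (s_elt n i, one_hk, one_hk))) = mat_scale c e"
      unfolding x using c e by blast
    show "\<exists>!\<psi> :: ((int \<times> nat list set \<times> nat list set) option \<Rightarrow> 'k) \<Rightarrow> 'k^'r^'r.
        \<psi> \<in> extensional (calg U) \<and> irreducible_representation U \<psi> \<and>
        (\<forall>f\<in>calg T. \<psi> (calg_map (M_incl n i) f) = \<phi> f)"
    proof (rule ex1I)
      have "irreducible_representation U \<psi>"
        using assms(4) rep_\<psi>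
        by (rule irreducible_representation_of_image) (use extends M_incl_calg in blast)
      then show "\<psi> \<in> extensional (calg U) \<and> irreducible_representation U \<psi> \<and>
          (\<forall>f\<in>calg T. \<psi> (calg_map (M_incl n i) f) = \<phi> f)"
        using extends by (simp add: \<psi>_def)
    next
      fix \<psi>' :: "((int \<times> nat list set \<times> nat list set) option \<Rightarrow> 'k) \<Rightarrow> 'k^'r^'r"
      assume \<psi>': "\<psi>' \<in> extensional (calg U) \<and> irreducible_representation U \<psi>' \<and>
          (\<forall>f\<in>calg T. \<psi>' (calg_map (M_incl n i) f) = \<phi> f)"
      then have rep': "representation U \<psi>'"
        by (simp add: irreducible_representation_def)
      have one: "\<psi>' (calg_elt U (Some (1, a, b))) = E 1 a b" if "a \<in> A" "b \<in> B" for a b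
      proof -
        have "calg_elt T (triple 1 a b) \<in> (calg T :: (_ \<Rightarrow> 'k) set)"
          using that by (intro T.calg_elt_closed triple_in) simp_all
        then show ?thesis
          using \<psi>' M_incl_elt[of 1 a b] by (metis E_def of_nat_1)
      qed
      have elt: "\<psi>' (calg_elt U (Some (z, a, b))) = g (Some (z, a, b))" if ab: "a \<in> A" "b \<in> B" for z a b
      proof -
        have "E.corner = \<psi>' (calg_elt U (Some (1, one_hk, one_hk)))"
          by (simp add: one one_in E.corner_def)
        from representation_gr_elt[OF rep' c this square ab] show ?thesis
          by (simp add: one ab g_def extended_values_def)
      qed
      show "\<psi>' = \<psi>"
      proof (rule extensionalityI)
        show "\<psi>' \<in> extensional (calg U)" "\<psi> \<in> extensional (calg U)"
          using \<psi>' by (simp_all add: \<psi>_def)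
        fix f :: "_ \<Rightarrow> 'k" assume f: "f \<in> calg U"
        have "\<psi>' f = linear_extension (\<lambda>x. \<psi>' (calg_elt U x)) f"
          by (rule U.representation_eq_linear_extension[OF rep' f])
        also have "\<dots> = linear_extension g f"
        proof (rule linear_extension_cong)
          fix u assume "f u \<noteq> 0"
          then have "u \<in> carrier U - {szero U}" using f by (auto simp: calg_def)
          then show "\<psi>' (calg_elt U u) = g u"
            by (auto simp: carrier_U szero_U elt)
        qed
        finally show "\<psi>' f = \<psi> f" using \<psi>_eq[OF f] by simp
      qed
    qed
  qed
qed

end
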